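(* Let $G=\operatorname{PGL}_2(\mathbb{R})$, $\Gamma=\operatorname{PGL}_2(\mathbb{Z})$, $X=\Gamma\backslash G$ and $H=\{\operatorname{diag}(e^{t/2},e^{-t/2}):t\in\mathbb{R}\}$ (so the $H$-action is the geodesic flow on the unit tangent bundle of the modular surface). For every $\varepsilon>0$ there exists $\delta>0$ such that $$\sum_{\Gamma gH \text{ periodic},\ \operatorname{disc}(\Gamma gH)\le \Delta,\ \Gamma gH\subset \Omega'_\delta}\mathrm{vol}(\Gamma gH)\gg_\varepsilon \Delta^{1-\varepsilon}.$$
   Context: A periodic $H$-orbit is a compact $H$-orbit; its volume is the covolume of $g^{-1}\Gamma g\cap H$ in $H$, measured with the parameter $t$ (i.e. the length of the closed geodesic). Its discriminant is defined as follows: with $\mathfrak g=M_2(\mathbb{Q})/\mathbb{Q} I$, $\mathfrak g_{\mathbb Z}$ the image of $M_2(\mathbb Z)$, and $B(X,Y)=\operatorname{tr}(1)\operatorname{tr}(XY)-\operatorname{tr}(X)\operatorname{tr}(Y)$ (tr = trace of left multiplication on $M_2(\mathbb{Q})$), $\operatorname{disc}(\Gamma gH)=B(e,e)$ where $e$ generates the rank one lattice $\operatorname{Ad}(g)\mathfrak h\cap\mathfrak g_{\mathbb Z}$; it is a fixed constant multiple of the discriminant of the associated real quadratic order. For $\delta>0$, identifying $\Gamma g$ with the homothety class of the lattice $\mathbb{Z}^2 g\subset\mathbb{R}^2$, $\Omega'_\delta=\{\Gamma g\in X: \|mg\|_\infty^2\ge \delta|\det g| \text{ for all nonzero } m\in\mathbb{Z}^2\}$,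 a compact set. *)

theory Defs
  imports "HOL-Analysis.Analysis" "HOL-Library.Extended_Nonnegative_Real"
begin

type_synonym mat2 = "real^2^2"

definition GL2R :: "mat2 set" where
  "GL2R = {g. det g \<noteq> 0}"

definition GL2Z :: "mat2 set" where
  "GL2Z = {\<gamma>. (\<forall>i j. \<gamma>$i$j \<in> \<int>) \<and> \<bar>det \<gamma>\<bar> = 1}"

text \<open>The point Gamma g of X = Gamma \ G, represented as the set of all matrix
  representatives lambda * gamma * g.\<close>
definition cls :: "mat2 \<Rightarrow> mat2 set" where
  "cls g = {r *\<^sub>R (\<gamma> ** g) | r \<gamma>. r \<noteq> 0 \<and> \<gamma> \<in> GL2Z}"

definition Xpts :: "mat2 set set" where
  "Xpts = cls ` GL2R"

definition Xtop :: "mat2 set topology" where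
  "Xtop = topology (\<lambda>U. U \<subseteq> Xpts \<and> openin (top_of_set GL2R) (\<Union>U))"

definition aH :: "real \<Rightarrow> mat2" where
  "aH t = (\<chi> i j. if i = j then (if i = 1 then exp (t/2) else exp (-t/2)) else 0)"

definition Horbit :: "mat2 \<Rightarrow> mat2 set set" where
  "Horbit g = {cls (g ** aH t) | t. True}"

definition Horbits :: "mat2 set set set" where
  "Horbits = Horbit ` GL2R"

definition periodic :: "mat2 set set \<Rightarrow> bool" where
  "periodic Ob \<longleftrightarrow> Ob \<in> Horbits \<and> compactin Xtop Ob"

text \<open>Volume: covolume of the stabilizer g^{-1} Gamma g \<inter> H in H, measured in t,
  i.e. the smallest positive t in the stabilizer lattice.\<close>
definition orbit_vol :: "mat2 set set \<Rightarrow> real" where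
  "orbit_vol Ob = Inf {t. t > 0 \<and> (\<forall>g\<in>GL2R. cls g \<in> Ob \<longrightarrow> cls (g ** aH t) = cls g)}"

text \<open>Bilinear form B(X,Y) = tr(1) tr(XY) - tr(X) tr(Y), where tr is the trace of left
  multiplication on M_2(Q) (a 4-dimensional space), i.e. tr_L(X) = 2 trace X, tr_L(1) = 4.\<close>
definition trL :: "mat2 \<Rightarrow> real" where
  "trL A = 2 * trace A"

definition Bform :: "mat2 \<Rightarrow> mat2 \<Rightarrow> real" where
  "Bform A C = trL (mat 1) * trL (A ** C) - trL A * trL C"

text \<open>D generates the Lie algebra of H (modulo scalars).\<close>
definition Dh :: mat2 where
  "Dh = (\<chi> i j. if i = j then (if i = 1 then 1 else -1) else 0)"

text \<open>Ad(g) h \<inter> g_Z: coefficients s such that the class of s * g D g^{-1} modulo scalars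
  is the class of an integer matrix.\<close>
definition lat_coeffs :: "mat2 \<Rightarrow> real set" where
  "lat_coeffs g = {s. \<exists>Z c. (\<forall>i j. Z$i$j \<in> \<int>) \<and>
        Z = s *\<^sub>R (g ** Dh ** matrix_inv g) + c *\<^sub>R mat 1}"

text \<open>A generator e = s_0 * Ad(g) D of the rank-one lattice (s_0 the least positive coefficient),
  and disc = B(e,e) (B is invariant under adding scalars, so well defined on g).\<close>
definition disc_of :: "mat2 \<Rightarrow> real" where
  "disc_of g = (let e = Inf {s \<in> lat_coeffs g. s > 0} *\<^sub>R (g ** Dh ** matrix_inv g)
                in Bform e e)"

definition orbit_disc :: "mat2 set set \<Rightarrow> real" where
  "orbit_disc Ob = disc_of (SOME g. g \<in> GL2R \<and> Ob = Horbit g)"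

definition supnorm2 :: "real^2 \<Rightarrow> real" where
  "supnorm2 v = max \<bar>v$1\<bar> \<bar>v$2\<bar>"

definition Omega' :: "real \<Rightarrow> mat2 set set" where
  "Omega' \<delta> = {cls g | g. g \<in> GL2R \<and>
      (\<forall>m::real^2. (\<forall>i. m$i \<in> \<int>) \<and> m \<noteq> 0 \<longrightarrow> (supnorm2 (m v* g))\<^sup>2 \<ge> \<delta> * \<bar>det g\<bar>)}"

end

theory Submission
  imports Defs "HOL-Real_Asymp.Real_Asymp"
begin

text \<open>
  A nonempty word of even length in the digits \<open>1, ..., K\<close> gives a closed geodesic whose endpoints
  are purely periodic continued fractions with these digits. As the digits are bounded, its endpoints
  are uniformly badly approximable, which keeps the geodesic in a compact set depending only on \<open>K\<close>,
  and its discriminant is at most a constant times the square of the denominator of the word.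

  A cylinder interval of length \<open>I\<close> splits into pieces of length at most \<open>I / 2\<close>, and the pieces with
  digit at most \<open>K\<close> fill it up to a fraction \<open>O(1/K)\<close>. For an exponent \<open>s < 1\<close> and \<open>K\<close> large the sum of
  the \<open>s\<close>-th powers of the lengths of these pieces is therefore at least \<open>I\<^sup>s\<close>, so there are at least of
  order \<open>\<Delta>\<^sup>s\<close> words with squared denominator at most \<open>\<Delta>\<close>. By compactness only \<open>O((log \<Delta>)\<^sup>2)\<close> words
  share an orbit, and every orbit has volume at least \<open>1\<close>, because the trace of its hyperbolic matrix
  is an integer exceeding \<open>2\<close>.
\<close>

section \<open>Two-by-two matrices and the space of lattices\<close>

text \<open>With explicit entries the simplifier turns matrix identities into polynomial
  identities.\<close>

definition mat2_of :: "real \<Rightarrow> real \<Rightarrow> real \<Rightarrow> real \<Rightarrow> mat2" where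
  "mat2_of a b c d = (\<chi> i j. if i = 1 then (if j = 1 then a else b) else (if j = 1 then c else d))"

lemma mat2_of_nth [simp]:
  "mat2_of a b c d $ 1 $ 1 = a" "mat2_of a b c d $ 1 $ 2 = b"
  "mat2_of a b c d $ 2 $ 1 = c" "mat2_of a b c d $ 2 $ 2 = d"
  by (simp_all add: mat2_of_def)

lemma mat2_eq_iff:
  "A = B \<longleftrightarrow> A$1$1 = B$1$1 \<and> A$1$2 = B$1$2 \<and> A$2$1 = B$2$1 \<and> A$2$2 = B$2$2"
  for A B :: mat2
  by (auto simp: vec_eq_iff forall_2)

lemma mat2_of_eta: "A = mat2_of (A$1$1) (A$1$2) (A$2$1) (A$2$2)"
  by (simp add: mat2_eq_iff)

lemma mat2_cases [case_names mat2_of]: obtains a b c d where "A = mat2_of a b c d"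
  using mat2_of_eta by blast

lemma mat2_of_eq_iff [simp]: "mat2_of a b c d = mat2_of a' b' c' d' \<longleftrightarrow> a = a' \<and> b = b' \<and> c = c' \<and> d = d'"
  by (simp add: mat2_eq_iff)

lemma mat2_of_mult [simp]:
  "mat2_of a b c d ** mat2_of a' b' c' d' = mat2_of (a*a' + b*c') (a*b' + b*d') (c*a' + d*c') (c*b' + d*d')"
  by (simp add: mat2_eq_iff matrix_matrix_mult_def sum_2)

lemma mat2_of_scaleR [simp]: "r *\<^sub>R mat2_of a b c d = mat2_of (r*a) (r*b) (r*c) (r*d)"
  by (simp add: mat2_eq_iff)

lemma mat2_of_add [simp]: "mat2_of a b c d + mat2_of a' b' c' d' = mat2_of (a+a') (b+b') (c+c') (d+d')"
  by (simp add: mat2_eq_iff)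

lemma mat_1_mat2_of: "mat 1 = mat2_of 1 0 0 1"
  by (simp add: mat2_eq_iff mat_def)

lemma det_mat2_of [simp]: "det (mat2_of a b c d) = a*d - b*c"
  by (simp add: det_2)

lemma trace_mat2_of [simp]: "trace (mat2_of a b c d) = a + d"
  by (simp add: trace_def sum_2)

lemma aH_mat2_of: "aH t = mat2_of (exp (t/2)) 0 0 (exp (-t/2))"
  by (simp add: mat2_eq_iff aH_def)

lemma Dh_mat2_of: "Dh = mat2_of 1 0 0 (-1)"
  by (simp add: mat2_eq_iff Dh_def)

lemma aH_add: "aH s ** aH t = aH (s + t)"
  by (simp add: aH_mat2_of add_divide_distrib exp_add [symmetric] diff_divide_distrib)

lemma aH_0 [simp]: "aH 0 = mat 1"
  by (simp add: aH_mat2_of mat_1_mat2_of)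

lemma det_aH [simp]: "det (aH t) = 1"
  by (simp add: aH_mat2_of exp_add [symmetric])

lemma scaleR_matrix_mult: "(r *\<^sub>R A) ** B = r *\<^sub>R (A ** B)" "A ** (r *\<^sub>R B) = r *\<^sub>R (A ** B)"
  for A B :: mat2
  by (simp_all add: mat2_eq_iff matrix_matrix_mult_def sum_2 algebra_simps)

lemma det_scaleR_mat2: "det (r *\<^sub>R A) = r\<^sup>2 * det A" for A :: mat2
  by (cases A rule: mat2_cases) (simp add: power2_eq_square algebra_simps)

lemma GL2Z_mat2_of: "mat2_of a b c d \<in> GL2Z \<longleftrightarrow> a \<in> \<int> \<and> b \<in> \<int> \<and> c \<in> \<int> \<and> d \<in> \<int> \<and> \<bar>a*d - b*c\<bar> = 1"
  by (simp add: GL2Z_def forall_2)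

lemma GL2Z_mult:
  assumes "A \<in> GL2Z" "B \<in> GL2Z"
  shows "A ** B \<in> GL2Z"
proof -
  have "\<bar>det (A ** B)\<bar> = 1"
    using assms by (simp add: GL2Z_def det_mul abs_mult)
  moreover have "(A ** B) $ i $ j \<in> \<int>" for i j
    using assms by (auto simp: GL2Z_def matrix_matrix_mult_def sum_2)
  ultimately show ?thesis
    by (simp add: GL2Z_def)
qed

lemma GL2Z_1 [simp]: "mat 1 \<in> GL2Z"
  by (simp add: mat_1_mat2_of GL2Z_mat2_of)

lemma GL2Z_inverse:
  assumes "A \<in> GL2Z"
  obtains B where "B \<in> GL2Z" "A ** B = mat 1" "B ** A = mat 1"
proof (cases A rule: mat2_cases)
  case (mat2_of a b c d)
  define e where "e = a*d - b*c"
  have e: "e = 1 \<or> e = -1" and ints: "a \<in> \<int>" "b \<in> \<int>" "c \<in> \<int>" "d \<in> \<int>"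
    using assms by (auto simp: mat2_of GL2Z_mat2_of e_def)
  \<comment> \<open>The adjugate times the determinant \<open>e\<close>. As \<open>e\<close> is its
    own reciprocal, this is the inverse and it stays integral.\<close>
  let ?B = "mat2_of (d*e) (-b*e) (-c*e) (a*e)"
  have "e \<in> \<int>" "e * e = 1"
    using e by auto
  have "d*e*(a*e) - -b*e*(-c*e) = (e*e) * e"
    unfolding e_def by algebra
  then have "\<bar>d*e*(a*e) - -b*e*(-c*e)\<bar> = 1"
    using e by auto
  then have "?B \<in> GL2Z"
    using ints \<open>e \<in> \<int>\<close> by (simp add: GL2Z_mat2_of)
  moreover have "e * (a*d - b*c) = 1"
    using \<open>e * e = 1\<close> by (simp add: e_def)
  then have "A ** ?B = mat 1" "?B ** A = mat 1"
    by (simp_all add: mat2_of mat_1_mat2_of algebra_simps)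
  ultimately show ?thesis
    by (rule that)
qed

section \<open>Points of X as classes modulo scalars and integral base change\<close>

lemma cls_iff: "h \<in> cls g \<longleftrightarrow> (\<exists>r \<sigma>. r \<noteq> 0 \<and> \<sigma> \<in> GL2Z \<and> h = r *\<^sub>R (\<sigma> ** g))"
  by (auto simp: cls_def)

lemma cls_refl [simp]: "g \<in> cls g"
  unfolding cls_iff by (rule exI [of _ 1], rule exI [of _ "mat 1"]) simp

lemma cls_sym: "h \<in> cls g \<Longrightarrow> g \<in> cls h"
proof -
  assume "h \<in> cls g"
  then obtain r \<sigma> where *: "r \<noteq> 0" "\<sigma> \<in> GL2Z" "h = r *\<^sub>R (\<sigma> ** g)"
    by (auto simp: cls_iff)
  obtain \<tau> where \<tau>: "\<tau> \<in> GL2Z" "\<tau> ** \<sigma> = mat 1"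
    using GL2Z_inverse [OF *(2)] by metis
  have "g = (1/r) *\<^sub>R (\<tau> ** h)"
    using * \<tau> by (simp add: scaleR_matrix_mult matrix_mul_assoc)
  then show ?thesis
    unfolding cls_iff using * \<tau> by (metis divide_eq_0_iff one_neq_zero)
qed

lemma cls_trans: "h \<in> cls g \<Longrightarrow> k \<in> cls h \<Longrightarrow> k \<in> cls g"
proof -
  assume "h \<in> cls g" "k \<in> cls h"
  then obtain r \<sigma> r' \<sigma>' where *: "r \<noteq> 0" "\<sigma> \<in> GL2Z" "h = r *\<^sub>R (\<sigma> ** g)"
    "r' \<noteq> 0" "\<sigma>' \<in> GL2Z" "k = r' *\<^sub>R (\<sigma>' ** h)"
    unfolding cls_iff by metis
  then have "k = (r' * r) *\<^sub>R ((\<sigma>' ** \<sigma>) ** g)"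
    by (simp add: scaleR_matrix_mult matrix_mul_assoc)
  then show ?thesis
    unfolding cls_iff using * GL2Z_mult by (metis mult_eq_0_iff)
qed

lemma cls_eq_iff: "cls h = cls g \<longleftrightarrow> h \<in> cls g"
  using cls_sym cls_trans by (metis cls_refl subsetI subset_antisym)

lemma cls_mult_right: "h \<in> cls g \<Longrightarrow> h ** a \<in> cls (g ** a)"
  by (metis cls_iff scaleR_matrix_mult(1) matrix_mul_assoc)

lemma GL2R_in_cls: "h \<in> cls g \<Longrightarrow> g \<in> GL2R \<Longrightarrow> h \<in> GL2R"
  by (auto simp: cls_iff GL2R_def GL2Z_def det_scaleR_mat2 det_mul)

lemma GL2R_aH: "g \<in> GL2R \<Longrightarrow> g ** aH t \<in> GL2R"
  by (simp add: GL2R_def det_mul)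

section \<open>The quotient topology on X\<close>

lemma istopology_Xtop: "istopology (\<lambda>U. U \<subseteq> Xpts \<and> openin (top_of_set GL2R) (\<Union>U))"
proof -
  \<comment> \<open>Distinct points of X are disjoint sets of matrices, so a matrix common to both
    unions comes from one common class.\<close>
  have inter: "\<Union>(S \<inter> T) = \<Union>S \<inter> \<Union>T" if "S \<subseteq> Xpts" "T \<subseteq> Xpts" for S T
  proof -
    have "A = B" if "x \<in> A" "x \<in> B" "A \<in> S" "B \<in> T" for x A B
    proof -
      have "A \<in> Xpts" "B \<in> Xpts"
        using that \<open>S \<subseteq> Xpts\<close> \<open>T \<subseteq> Xpts\<close> by auto
      then show ?thesis
        using that(1,2) unfolding Xpts_def by (metis cls_eq_iff imageE)
    qed
    then show ?thesis
      by blast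
  qed
  have "openin (top_of_set GL2R) (\<Union>(\<Union>\<K>))"
    if "\<forall>K\<in>\<K>. K \<subseteq> Xpts \<and> openin (top_of_set GL2R) (\<Union>K)" for \<K>
  proof -
    have "\<Union>(\<Union>\<K>) = \<Union>(Union ` \<K>)"
      by blast
    then show ?thesis
      using that by (metis (no_types, lifting) imageE openin_Union)
  qed
  moreover have "openin (top_of_set GL2R) (\<Union>(S \<inter> T))"
    if "S \<subseteq> Xpts" "T \<subseteq> Xpts" "openin (top_of_set GL2R) (\<Union>S)" "openin (top_of_set GL2R) (\<Union>T)"
    for S T
    using inter [OF that(1,2)] that(3,4) by (simp add: openin_Int)
  ultimately show ?thesis
    unfolding istopology_def by (intro conjI allI impI) blast+
qed

lemma openin_Xtop: "openin Xtop U \<longleftrightarrow> U \<subseteq> Xpts \<and> openin (top_of_set GL2R) (\<Union>U)"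
  unfolding Xtop_def using istopology_Xtop by (simp add: topology_inverse')

lemma Union_Xpts: "\<Union>Xpts = GL2R"
proof
  show "\<Union>Xpts \<subseteq> GL2R"
    using GL2R_in_cls by (auto simp: Xpts_def)
  show "GL2R \<subseteq> \<Union>Xpts"
    using cls_refl by (auto simp: Xpts_def simp del: cls_refl)
qed

lemma topspace_Xtop: "topspace Xtop = Xpts"
proof
  show "topspace Xtop \<subseteq> Xpts"
    using openin_Xtop openin_topspace by blast
  have "openin Xtop Xpts"
    unfolding openin_Xtop using Union_Xpts by simp
  then show "Xpts \<subseteq> topspace Xtop"
    by (rule openin_subset)
qed

lemma continuous_on_aH: "continuous_on UNIV (\<lambda>t. g ** aH t)"
proof -
  have "g ** aH t = (\<chi> i j. g$i$1 * aH t$1$j + g$i$2 * aH t$2$j)" for t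
    by (simp add: matrix_matrix_mult_def sum_2)
  moreover have "continuous_on UNIV (\<lambda>t. aH t $ i $ j)" for i j
    unfolding aH_def by (cases "i = j"; cases "i = 1") (auto intro!: continuous_intros)
  ultimately show ?thesis
    by (simp only:) (intro continuous_on_vec_lambda continuous_on_add continuous_on_mult continuous_on_const)
qed

text \<open>The union of an open set of classes is saturated, so a class belongs to the set as soon
  as one representative lies in the union. Continuity thus reduces to that of the matrix
  path.\<close>

lemma continuous_map_cls_aH:
  assumes "g \<in> GL2R"
  shows "continuous_map euclideanreal Xtop (\<lambda>t. cls (g ** aH t))"
  unfolding continuous_map_def
proof (intro conjI allI impI)
  show "(\<lambda>t. cls (g ** aH t)) \<in> topspace euclideanreal \<rightarrow> topspace Xtop"
    using assms GL2R_aH by (auto simp: topspace_Xtop Xpts_def)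
next
  fix U assume U: "openin Xtop U"
  then obtain V where V: "open V" "\<Union>U = GL2R \<inter> V"
    by (auto simp: openin_Xtop openin_open)
  have "cls (g ** aH t) \<in> U \<longleftrightarrow> g ** aH t \<in> V" for t
  proof
    assume "cls (g ** aH t) \<in> U"
    then show "g ** aH t \<in> V"
      using V(2) cls_refl by blast
  next
    assume "g ** aH t \<in> V"
    then have "g ** aH t \<in> \<Union>U"
      using V(2) GL2R_aH assms by blast
    then obtain A where "A \<in> U" "g ** aH t \<in> A"
      by blast
    moreover then have "A \<in> Xpts"
      using U openin_Xtop by blast
    ultimately show "cls (g ** aH t) \<in> U"
      by (metis Xpts_def cls_eq_iff imageE)
  qed
  then have "{t. cls (g ** aH t) \<in> U} = (\<lambda>t. g ** aH t) -` V"
    by auto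
  then show "openin euclideanreal {t \<in> topspace euclideanreal. cls (g ** aH t) \<in> U}"
    using open_vimage [OF V(1) continuous_on_aH] by simp
qed

section \<open>Counting continued fraction words\<close>

text \<open>Digits \<open>w\<close> applied to a bottom row \<open>(c, d)\<close> of a continued fraction matrix; the
  reciprocal of the result is the length of the corresponding cylinder interval.\<close>

fun wt :: "nat list \<Rightarrow> real \<Rightarrow> real \<Rightarrow> real" where
  "wt [] c d = d * (c + d)"
| "wt (b # w) c d = wt w d (c + real b * d)"

text \<open>A further digit \<open>b\<close> replaces the row \<open>(c, d)\<close> by
  \<open>(d, c + b * d)\<close>. The lower bound says that a child interval has at most half the
  length of its parent; the upper bound limits the overshoot when splitting stops.\<close>

lemma wt_child_bounds:
  fixes c d :: real
  assumes "0 \<le> c" "c \<le> d" "0 < d" "1 \<le> b" "b \<le> K"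
  shows "2 * (d * (c + d)) \<le> (c + real b * d) * (d + (c + real b * d))"
    and "(c + real b * d) * (d + (c + real b * d)) \<le> (real K + 1)\<^sup>2 * (d * (c + d))"
proof -
  have 1: "d \<le> real b * d"
    using assms by simp
  have "c + d \<le> c + real b * d" "2 * d \<le> d + (c + real b * d)" "0 \<le> c + real b * d"
    using assms 1 by linarith+
  then have "(c + d) * (2 * d) \<le> (c + real b * d) * (d + (c + real b * d))"
    using assms by (intro mult_mono) auto
  then show "2 * (d * (c + d)) \<le> (c + real b * d) * (d + (c + real b * d))"
    by (simp add: algebra_simps)
  have 2: "real b * d \<le> real K * d"
    using assms by simp
  have 3: "0 \<le> real K * c" "0 \<le> real K * d"
    using assms by simp_all
  have "c + real b * d \<le> (real K + 1) * d" "d + (c + real b * d) \<le> (real K + 1) * (c + d)"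
    "0 \<le> (real K + 1) * d" "0 \<le> d + (c + real b * d)"
    unfolding distrib_left distrib_right using assms 1 2 3 by linarith+
  then have "(c + real b * d) * (d + (c + real b * d)) \<le> ((real K + 1) * d) * ((real K + 1) * (c + d))"
    by (intro mult_mono) auto
  then show "(c + real b * d) * (d + (c + real b * d)) \<le> (real K + 1)\<^sup>2 * (d * (c + d))"
    by (simp add: power2_eq_square algebra_simps)
qed

lemma wt_ge_power_length:
  assumes "set w \<subseteq> {1..K}" "0 \<le> c" "c \<le> d" "0 < d"
  shows "2 ^ length w * (d * (c + d)) \<le> wt w c d"
  using assms
proof (induction w arbitrary: c d)
  case (Cons b w)
  have b: "1 \<le> b" "b \<le> K"
    using Cons.prems by auto
  have "d \<le> real b * d"
    using b Cons.prems by simp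
  then have "d \<le> c + real b * d"
    using Cons.prems by linarith
  then have "2 ^ length w * ((c + real b * d) * (d + (c + real b * d))) \<le> wt w d (c + real b * d)"
    using Cons.prems by (intro Cons.IH) (auto simp del: mult_le_cancel_right2 mult_le_cancel_right1)
  moreover have "2 ^ length w * (2 * (d * (c + d))) \<le> 2 ^ length w * ((c + real b * d) * (d + (c + real b * d)))"
    using wt_child_bounds(1) [OF Cons.prems(2-4) b] by (intro mult_left_mono) auto
  ultimately show ?case
    by (simp add: algebra_simps)
qed simp

lemma finite_wt_le:
  assumes "0 \<le> c" "c \<le> d" "0 < d"
  shows "finite {w. set w \<subseteq> {1..K} \<and> even (length w) \<and> wt w c d \<le> Y}"
proof -
  obtain n where n: "Y / (d * (c + d)) < 2 ^ n"
    using real_arch_pow [of 2] by auto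
  have pos: "0 < d * (c + d)"
    using assms by simp
  have "length w \<le> n" if "set w \<subseteq> {1..K}" "wt w c d \<le> Y" for w
  proof (rule ccontr)
    assume "\<not> length w \<le> n"
    then have "(2::real) ^ n \<le> 2 ^ length w"
      by (intro power_increasing) auto
    then have "2 ^ n * (d * (c + d)) \<le> 2 ^ length w * (d * (c + d))"
      using pos by (intro mult_right_mono) auto
    also have "\<dots> \<le> Y"
      using wt_ge_power_length [OF that(1) assms] that(2) by simp
    finally show False
      using n pos by (simp add: field_simps)
  qed
  then show ?thesis
    by (intro finite_subset [OF _ finite_lists_length_le [of "{1..K}" n]]) auto
qed

text \<open>The child intervals are adjacent, so the sum telescopes: each summand is
  \<open>1 / d\<close> times the difference of the reciprocals of \<open>c + b * d\<close> and
  \<open>c + (b + 1) * d\<close>.\<close>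

lemma sum_child_weights:
  fixes c d :: real
  assumes "0 \<le> c" "0 < d"
  shows "(\<Sum>b=1..K. 1 / ((c + real b * d) * (d + (c + real b * d)))) =
    1 / d * (1 / (c + d) - 1 / (c + (real K + 1) * d))"
proof (induction K)
  case (Suc K)
  have "0 < c + (real K + 1) * d" "0 < c + (real K + 2) * d"
    using assms by (auto intro!: add_nonneg_pos)
  then have "1 / ((c + (real K + 1) * d) * (c + (real K + 2) * d)) =
      1 / d * (1 / (c + (real K + 1) * d) - 1 / (c + (real K + 2) * d))"
    using assms(2) by (simp add: divide_simps) (simp add: algebra_simps)
  then show ?case
    using Suc by (simp add: algebra_simps)
qed (use assms in simp)

text \<open>Each child weighs at most half of its parent while the children lose only the fraction
  \<open>2 / (K + 2)\<close> of the total weight; an exponent below one therefore wins for large \<open>K\<close>.\<close>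

lemma sum_child_weights_powr:
  fixes c d s :: real
  assumes cd: "0 \<le> c" "c \<le> d" "0 < d" and s: "s \<le> 1"
    and K: "1 \<le> 2 powr (1 - s) * (1 - 2 / (real K + 2))"
  shows "(1 / (d * (c + d))) powr s \<le>
    (\<Sum>b=1..K. (1 / ((c + real b * d) * (d + (c + real b * d)))) powr s)"
proof -
  define q where "q = d * (c + d)"
  define Q where "Q b = (c + real b * d) * (d + (c + real b * d))" for b :: nat
  have q: "0 < q"
    using cd by (simp add: q_def)
  have Q: "2 * q \<le> Q b" if "b \<in> {1..K}" for b
    using wt_child_bounds(1) [OF cd, of b K] that by (simp add: q_def Q_def)
  have "1 / q * (1 - 2 / (real K + 2)) \<le> (\<Sum>b=1..K. 1 / Q b)"
  proof -
    \<comment> \<open>The part of the parent left uncovered by digits up to \<open>K\<close> is at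
      most the fraction \<open>2 / (K + 2)\<close>; after expanding this is
      \<open>K * c \<le> K * d\<close>.\<close>
    have "(c + d) * (real K + 2) \<le> 2 * (c + (real K + 1) * d)"
      using cd mult_left_mono [OF cd(2), of "real K"] by (simp add: algebra_simps)
    moreover have "0 < c + (real K + 1) * d"
      using cd by (intro add_nonneg_pos) auto
    ultimately have "1 / (c + (real K + 1) * d) \<le> 2 / (real K + 2) * (1 / (c + d))"
      using cd by (simp add: divide_simps mult.commute)
    then have "1 / d * (1 / (c + d) * (1 - 2 / (real K + 2))) \<le> 1 / d * (1 / (c + d) - 1 / (c + (real K + 1) * d))"
      using cd by (intro mult_left_mono) (auto simp: algebra_simps)
    also have "1 / d * (1 / (c + d) * (1 - 2 / (real K + 2))) = 1 / q * (1 - 2 / (real K + 2))"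
      by (simp add: q_def)
    finally show ?thesis
      using sum_child_weights [OF cd(1,3), of K] by (simp add: Q_def)
  qed
  \<comment> \<open>The exponent \<open>s - 1\<close> is at most 0 and every child weighs at most
    \<open>1 / (2*q)\<close>, so this factor is a lower bound for each
    \<open>(1 / Q b) powr (s - 1)\<close>. It is the source of the gain
    \<open>2 powr (1 - s)\<close>.\<close>
  then have "(1 / (2*q)) powr (s - 1) * (1 / q * (1 - 2 / (real K + 2))) \<le> (1 / (2*q)) powr (s - 1) * (\<Sum>b=1..K. 1 / Q b)"
    by (intro mult_left_mono) auto
  also have "\<dots> = (\<Sum>b=1..K. (1 / (2*q)) powr (s - 1) * (1 / Q b))"
    by (simp only: sum_distrib_left)
  also have "\<dots> \<le> (\<Sum>b=1..K. (1 / Q b) powr s)"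
  proof (rule sum_mono)
    fix b assume b: "b \<in> {1..K}"
    have "0 < Q b"
      using Q [OF b] q by simp
    then have "(1 / (2*q)) powr (s - 1) \<le> (1 / Q b) powr (s - 1)"
      using Q [OF b] q s by (intro powr_mono2') (auto simp: divide_simps)
    then have "(1 / (2*q)) powr (s - 1) * (1 / Q b) \<le> (1 / Q b) powr (s - 1) * (1 / Q b) powr 1"
      using \<open>0 < Q b\<close> by (simp add: divide_right_mono)
    also have "\<dots> = (1 / Q b) powr s"
      by (simp only: powr_add [symmetric]) simp
    finally show "(1 / (2*q)) powr (s - 1) * (1 / Q b) \<le> (1 / Q b) powr s" .
  qed
  finally have "(1 / (2*q)) powr (s - 1) * (1 / q * (1 - 2 / (real K + 2))) \<le> (\<Sum>b=1..K. (1 / Q b) powr s)" .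
  moreover have "(1 / (2*q)) powr (s - 1) * (1 / q * (1 - 2 / (real K + 2))) =
      (1 / q) powr s * (2 powr (1 - s) * (1 - 2 / (real K + 2)))"
  proof -
    have e1: "(1 / (2*q)) powr (s - 1) = (1/2) powr (s - 1) * (1 / q) powr (s - 1)"
      using q by (simp add: powr_mult [symmetric])
    have e2: "(1/2::real) powr (s - 1) = 2 powr (1 - s)"
      by (simp add: powr_divide powr_diff)
    have e3: "(1 / q) powr s = (1 / q) powr (s - 1) * (1 / q)"
      using q by (simp add: powr_diff)
    show ?thesis
      unfolding e1 e2 e3 by (simp only: mult_ac)
  qed
  moreover have "(1 / q) powr s * 1 \<le> (1 / q) powr s * (2 powr (1 - s) * (1 - 2 / (real K + 2)))"
    using K by (intro mult_left_mono) auto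
  ultimately show ?thesis
    by (simp add: q_def Q_def)
qed

text \<open>Intervals with \<open>d * (c + d) < X\<close> are split two digits at a time, which
  keeps lengths even and does not decrease the sum of s-th powers. Once
  \<open>d * (c + d) \<ge> X\<close>, the empty word counts for at least the required amount. Two
  digits cost a factor of at most \<open>(K + 1)^4\<close>, which is the slack allowed in the bound
  on weights.\<close>

lemma card_wt_le:
  fixes c d s X :: real
  assumes s: "0 \<le> s" "s \<le> 1" and K: "1 \<le> 2 powr (1 - s) * (1 - 2 / (real K + 2))"
    and X: "0 < X" and cd: "0 \<le> c" "c \<le> d" "0 < d" and q: "d * (c + d) \<le> (real K + 1)^4 * X"
  shows "(X / (d * (c + d))) powr s \<le>
    real (card {w. set w \<subseteq> {1..K} \<and> even (length w) \<and> wt w c d \<le> (real K + 1)^4 * X})"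
proof -
  define R where "R = (real K + 1)^4 * X"
  define S where "S c d = {w. set w \<subseteq> {1..K} \<and> even (length w) \<and> wt w c d \<le> R}" for c d
  \<comment> \<open>Every splitting at least doubles \<open>d * (c + d)\<close>, so \<open>n\<close>
    bounds the depth.\<close>
  obtain n where "X / (d * (c + d)) < 2 ^ n"
    using real_arch_pow [of 2] by auto
  then have "X \<le> 2 ^ n * (d * (c + d))"
    using cd by (simp add: pos_divide_less_eq)
  then have "(X / (d * (c + d))) powr s \<le> real (card (S c d))"
    using cd q
  proof (induction n arbitrary: c d)
    case base: 0
    have "{[]} \<subseteq> S c d"
      using base by (simp add: S_def R_def)
    then have "1 \<le> card (S c d)"
      using finite_wt_le [OF base(2-4)] card_mono [of "S c d" "{[]}"] by (simp add: S_def)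
    moreover have "(X / (d * (c + d))) powr s \<le> 1"
      using base X s by (intro powr_le1) auto
    ultimately show ?case
      by linarith
  next
    case (Suc n)
    note cd = Suc.prems(2-4)
    define q where "q = d * (c + d)"
    have "0 < q"
      using cd by (simp add: q_def)
    show ?case
    proof (cases "X \<le> q")
      case True
      have "{[]} \<subseteq> S c d"
        using Suc.prems by (simp add: S_def R_def)
      then have "1 \<le> card (S c d)"
        using finite_wt_le [OF cd] card_mono [of "S c d" "{[]}"] by (simp add: S_def)
      moreover have "(X / q) powr s \<le> 1"
        using True X s \<open>0 < q\<close> by (intro powr_le1) auto
      ultimately show ?thesis
        by (simp add: q_def)
    next
      case False
      define d1 where "d1 b = c + real b * d" for b :: nat
      define d2 where "d2 b b' = d + real b' * d1 b" for b b' :: nat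
      have d1: "0 < d1 b" "d \<le> d1 b" if "b \<in> {1..K}" for b
      proof -
        have "d \<le> real b * d"
          using that cd by simp
        then show "0 < d1 b" "d \<le> d1 b"
          using cd unfolding d1_def by linarith+
      qed
      have d2: "0 < d2 b b'" "d1 b \<le> d2 b b'" if "b \<in> {1..K}" "b' \<in> {1..K}" for b b'
      proof -
        have "d1 b \<le> real b' * d1 b"
          using that d1 [OF that(1)] by simp
        then show "0 < d2 b b'" "d1 b \<le> d2 b b'"
          using cd d1 [OF that(1)] unfolding d2_def by linarith+
      qed
      have step: "(X / (d2 b b' * (d1 b + d2 b b'))) powr s \<le> real (card (S (d1 b) (d2 b b')))"
        if "b \<in> {1..K}" "b' \<in> {1..K}" for b b'
      proof (rule Suc.IH)
        show "0 \<le> d1 b" "d1 b \<le> d2 b b'" "0 < d2 b b'"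
          using d1 [OF that(1)] d2 [OF that] by auto
        have 1: "2 * q \<le> d1 b * (d + d1 b)" "d1 b * (d + d1 b) \<le> (real K + 1)\<^sup>2 * q"
          using wt_child_bounds [OF cd, of b K] that by (auto simp: d1_def q_def)
        have 2: "2 * (d1 b * (d + d1 b)) \<le> d2 b b' * (d1 b + d2 b b')"
          "d2 b b' * (d1 b + d2 b b') \<le> (real K + 1)\<^sup>2 * (d1 b * (d + d1 b))"
          using wt_child_bounds [of d "d1 b" b' K] d1 [OF that(1)] that cd by (auto simp: d2_def)
        have "X \<le> 2 ^ n * (2 * q)"
          using Suc.prems(1) by (simp add: q_def algebra_simps)
        also have "\<dots> \<le> 2 ^ n * (d2 b b' * (d1 b + d2 b b'))"
          using 1 2 \<open>0 < q\<close> by (intro mult_left_mono) auto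
        finally show "X \<le> 2 ^ n * (d2 b b' * (d1 b + d2 b b'))" .
        have "d2 b b' * (d1 b + d2 b b') \<le> (real K + 1)\<^sup>2 * ((real K + 1)\<^sup>2 * q)"
          using 1 2 by (meson mult_left_mono order_trans zero_le_power2)
        also have "\<dots> = (real K + 1)^4 * q"
          by (simp add: power2_eq_square power4_eq_xxxx)
        also have "\<dots> \<le> (real K + 1)^4 * X"
          using False by (intro mult_left_mono) auto
        finally show "d2 b b' * (d1 b + d2 b b') \<le> (real K + 1)^4 * X" .
      qed
      have "(X / q) powr s = X powr s * (1 / q) powr s"
        using X by (simp add: powr_mult [symmetric])
      also have "\<dots> \<le> X powr s * (\<Sum>b=1..K. (1 / (d1 b * (d + d1 b))) powr s)"
        using sum_child_weights_powr [OF cd s(2) K] by (intro mult_left_mono) (auto simp: q_def d1_def)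
      also have "\<dots> \<le> X powr s * (\<Sum>b=1..K. \<Sum>b'=1..K. (1 / (d2 b b' * (d1 b + d2 b b'))) powr s)"
      proof (intro mult_left_mono sum_mono)
        fix b assume "b \<in> {1..K}"
        then show "(1 / (d1 b * (d + d1 b))) powr s \<le> (\<Sum>b'=1..K. (1 / (d2 b b' * (d1 b + d2 b b'))) powr s)"
          using sum_child_weights_powr [OF _ _ _ s(2) K, of d "d1 b"] d1 cd by (auto simp: d2_def)
      qed auto
      also have "\<dots> = (\<Sum>b=1..K. \<Sum>b'=1..K. (X / (d2 b b' * (d1 b + d2 b b'))) powr s)"
        using X by (simp add: sum_distrib_left powr_mult [symmetric])
      also have "\<dots> \<le> (\<Sum>b=1..K. \<Sum>b'=1..K. real (card (S (d1 b) (d2 b b'))))"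
        by (intro sum_mono step)
      also have "\<dots> = (\<Sum>p\<in>{1..K}\<times>{1..K}. real (card (S (d1 (fst p)) (d2 (fst p) (snd p)))))"
        by (simp add: sum.cartesian_product case_prod_beta)
      also have "\<dots> = real (card (SIGMA p:{1..K}\<times>{1..K}. S (d1 (fst p)) (d2 (fst p) (snd p))))"
      proof -
        have "finite (S (d1 b) (d2 b b'))" if "b \<in> {1..K}" "b' \<in> {1..K}" for b b'
          using finite_wt_le [of "d1 b" "d2 b b'" K R] d1 [OF that(1)] d2 [OF that] by (auto simp: S_def)
        then show ?thesis
          by (subst card_SigmaI) auto
      qed
      also have "\<dots> \<le> real (card (S c d))"
      proof -
        \<comment> \<open>Prepending the two digits embeds the words of all grandchildren disjointly
          into those of the parent.\<close>
        let ?f = "\<lambda>(p, w). fst p # snd p # w :: nat list"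
        have "inj_on ?f (SIGMA p:{1..K}\<times>{1..K}. S (d1 (fst p)) (d2 (fst p) (snd p)))"
          by (auto simp: inj_on_def)
        moreover have "?f ` (SIGMA p:{1..K}\<times>{1..K}. S (d1 (fst p)) (d2 (fst p) (snd p))) \<subseteq> S c d"
          by (auto simp: S_def d1_def d2_def)
        ultimately show ?thesis
          using finite_wt_le [OF cd, of K R] by (auto simp: S_def intro!: card_inj_on_le)
      qed
      finally show ?thesis
        by (simp add: q_def)
    qed
  qed
  then show ?thesis
    by (simp add: S_def R_def)
qed

section \<open>Endpoints of closed geodesics\<close>

text \<open>The digit matrix acts on the line as x -> 1 / (b + x), so \<open>cf_mat w\<close> acts
  as \<open>cf_value w\<close>.\<close>

fun cf_mat :: "nat list \<Rightarrow> mat2" where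
  "cf_mat [] = mat 1"
| "cf_mat (b # w) = mat2_of 0 1 1 (real b) ** cf_mat w"

fun cf_value :: "nat list \<Rightarrow> real \<Rightarrow> real" where
  "cf_value [] x = x"
| "cf_value (b # w) x = 1 / (real b + cf_value w x)"

text \<open>\<open>cf_mat w\<close> sends the point \<open>- cf_reverse w y\<close> to
  \<open>- y\<close>; a fixed point of \<open>cf_reverse w\<close> is thus the negative of a fixed
  point of \<open>cf_mat w\<close>.\<close>

fun cf_reverse :: "nat list \<Rightarrow> real \<Rightarrow> real" where
  "cf_reverse [] y = y"
| "cf_reverse (b # w) y = cf_reverse w (real b + 1 / y)"

text \<open>The columns represent the points \<alpha> and -\<beta>, so a matrix fixing both points
  becomes diagonal in this frame.\<close>

definition endpoint_mat :: "real \<Rightarrow> real \<Rightarrow> mat2" where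
  "endpoint_mat \<alpha> \<beta> = mat2_of \<alpha> (- \<beta>) 1 1"

lemma det_endpoint_mat [simp]: "det (endpoint_mat \<alpha> \<beta>) = \<alpha> + \<beta>"
  by (simp add: endpoint_mat_def)

lemma cf_value_append: "cf_value (v @ w) x = cf_value v (cf_value w x)"
  by (induction v) auto

lemma cf_reverse_append: "cf_reverse (v @ w) y = cf_reverse w (cf_reverse v y)"
  by (induction v arbitrary: y) auto

lemma cf_value_pos: "0 < x \<Longrightarrow> 0 < cf_value w x"
  by (induction w) (auto intro: add_nonneg_pos)

lemma cf_value_in_01:
  assumes "set w \<subseteq> {1..K}" "x \<in> {0..1}"
  shows "cf_value w x \<in> {0..1}"
  using assms by (induction w) (auto simp: divide_simps)

lemma cf_reverse_in_interval:
  assumes "set w \<subseteq> {1..K}" "y \<in> {1..real K + 1}"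
  shows "cf_reverse w y \<in> {1..real K + 1}"
  using assms
proof (induction w arbitrary: y)
  case (Cons b w)
  have "1 / y \<le> 1" "0 \<le> 1 / y" "1 \<le> real b" "real b \<le> real K"
    using Cons.prems by auto
  then have "real b + 1 / y \<in> {1..real K + 1}"
    by (simp add: add_mono add_increasing2)
  then show ?case
    using Cons by simp
qed simp

lemma continuous_on_cf_value:
  assumes "set w \<subseteq> {1..K}"
  shows "continuous_on {0..1} (cf_value w)"
  using assms
proof (induction w)
  case (Cons b w)
  have "real b + cf_value w x \<noteq> 0" if "x \<in> {0..1}" for x
    using cf_value_in_01 [of w K x] that Cons.prems by auto
  then show ?case
    using Cons by (auto intro!: continuous_intros)
qed (simp add: continuous_on_id)

lemma continuous_on_cf_reverse:
  assumes "set w \<subseteq> {1..K}"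
  shows "continuous_on {1..real K + 1} (cf_reverse w)"
  using assms
proof (induction w)
  case (Cons b w)
  have "(\<lambda>y. real b + 1 / y) ` {1..real K + 1} \<subseteq> {1..real K + 1}"
    using cf_reverse_in_interval [of "[b]" K] Cons.prems by auto
  moreover have "continuous_on {1..real K + 1} (\<lambda>y. real b + 1 / y)"
    by (auto intro!: continuous_intros)
  ultimately show ?case
    using Cons by (auto intro: continuous_on_compose2 [of "{1..real K + 1}" "cf_reverse w"])
qed (simp add: continuous_on_id)

text \<open>The endpoints \<open>\<alpha> = [0; w w w ...]\<close> and \<open>-\<beta>\<close>, where \<open>\<beta>\<close> is the purely periodic continued
  fraction of the reversed word, of the closed geodesic attached to the digits \<open>w\<close>.\<close>

definition endpoints :: "nat \<Rightarrow> nat list \<Rightarrow> real \<Rightarrow> real \<Rightarrow> bool" where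
  "endpoints K w \<alpha> \<beta> \<longleftrightarrow> w \<noteq> [] \<and> set w \<subseteq> {1..K} \<and> 0 < \<alpha> \<and> \<alpha> \<le> 1 \<and> 1 \<le> \<beta> \<and> \<beta> \<le> real K + 1 \<and>
    cf_value w \<alpha> = \<alpha> \<and> cf_reverse w \<beta> = \<beta>"

text \<open>Brouwer's theorem applies to the invariant intervals \<open>{0..1}\<close> and
  \<open>{1..K + 1}\<close>. The value 0 is excluded because a nonempty word only takes positive
  values.\<close>

lemma endpoints_exist:
  assumes "w \<noteq> []" "set w \<subseteq> {1..K}"
  shows "\<exists>\<alpha> \<beta>. endpoints K w \<alpha> \<beta>"
proof -
  obtain \<alpha> where \<alpha>: "\<alpha> \<in> {0..1}" "cf_value w \<alpha> = \<alpha>"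
    using brouwer [of "{0..1::real}" "cf_value w"] continuous_on_cf_value [OF assms(2)] cf_value_in_01 [OF assms(2)]
    by (auto simp: Pi_def)
  obtain \<beta> where "\<beta> \<in> {1..real K + 1}" "cf_reverse w \<beta> = \<beta>"
    using brouwer [of "{1..real K + 1}" "cf_reverse w"] continuous_on_cf_reverse [OF assms(2)] cf_reverse_in_interval [OF assms(2)]
    by (auto simp: Pi_def)
  moreover have "\<alpha> \<noteq> 0"
  proof
    assume "\<alpha> = 0"
    obtain b v where w: "w = b # v"
      using assms(1) by (cases w) auto
    then have "real b + cf_value v 0 > 0"
      using cf_value_in_01 [of v K 0] assms(2) by (auto intro: add_pos_nonneg)
    then show False
      using \<alpha> w \<open>\<alpha> = 0\<close> by simp
  qed
  ultimately show ?thesis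
    unfolding endpoints_def using \<alpha> assms by (intro exI [of _ \<alpha>] exI [of _ \<beta>]) auto
qed

text \<open>One step of the natural extension of the Gauss map: the first digit leaves the expansion
  of \<alpha> and enters that of \<beta>.\<close>

lemma endpoints_rotate:
  assumes "endpoints K (b # v) \<alpha> \<beta>"
  shows "endpoints K (v @ [b]) (1 / \<alpha> - real b) (real b + 1 / \<beta>)"
proof -
  have *: "set v \<subseteq> {1..K}" "1 \<le> b" "b \<le> K" "0 < \<alpha>" "\<alpha> \<le> 1" "1 \<le> \<beta>" "\<beta> \<le> real K + 1"
    "1 / (real b + cf_value v \<alpha>) = \<alpha>" "cf_reverse v (real b + 1 / \<beta>) = \<beta>"
    using assms by (auto simp: endpoints_def)
  have eq: "1 / \<alpha> - real b = cf_value v \<alpha>"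
    by (subst *(8) [symmetric]) simp
  have "0 < cf_value v \<alpha>" "cf_value v \<alpha> \<le> 1"
    using cf_value_pos * cf_value_in_01 [of v K \<alpha>] by auto
  moreover have "real b + 1 / \<beta> \<in> {1..real K + 1}"
    using cf_reverse_in_interval [of "[b]" K \<beta>] * by simp
  ultimately show ?thesis
    unfolding endpoints_def eq using * by (auto simp: cf_value_append cf_reverse_append)
qed

lemma endpoints_ge:
  assumes "endpoints K w \<alpha> \<beta>"
  shows "1 / (real K + 1) \<le> \<alpha>"
proof -
  obtain b v where w: "w = b # v"
    using assms by (cases w) (auto simp: endpoints_def)
  then have "1 / \<alpha> - real b \<le> 1" "b \<le> K" "0 < \<alpha>"
    using endpoints_rotate [of K b v] assms by (auto simp: endpoints_def)
  then have "1 / \<alpha> \<le> real K + 1"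
    by linarith
  then show ?thesis
    using \<open>0 < \<alpha>\<close> by (simp add: field_simps)
qed

text \<open>\<open>\<beta> / \<alpha>\<close> is the exponential of the time taken by one rotation.
  The lower bound ensures that finitely many rotations exhaust any given time, and the upper bound
  controls what happens before the first one.\<close>

lemma endpoints_ratio_bounds:
  assumes "endpoints K w \<alpha> \<beta>"
  shows "1 + 1 / (real K + 1) \<le> \<beta> / \<alpha>" "\<beta> / \<alpha> \<le> (real K + 1)\<^sup>2"
proof -
  obtain b v where w: "w = b # v"
    using assms by (cases w) (auto simp: endpoints_def)
  have *: "0 < \<alpha>" "1 \<le> \<beta>" "\<beta> \<le> real K + 1" "1 \<le> b"
    using assms w by (auto simp: endpoints_def)
  have "1 / (real K + 1) \<le> 1 / \<alpha> - real b"
    using endpoints_ge [OF endpoints_rotate] assms w by blast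
  then have "1 + 1 / (real K + 1) \<le> 1 / \<alpha>"
    using \<open>1 \<le> b\<close> by linarith
  also have "\<dots> \<le> \<beta> / \<alpha>"
    using * by (intro divide_right_mono) auto
  finally show "1 + 1 / (real K + 1) \<le> \<beta> / \<alpha>" .
  have "1 / \<alpha> \<le> real K + 1"
    using endpoints_ge [OF assms] * by (simp add: field_simps)
  then have "\<beta> * (1 / \<alpha>) \<le> (real K + 1) * (real K + 1)"
    using * by (intro mult_mono) auto
  then show "\<beta> / \<alpha> \<le> (real K + 1)\<^sup>2"
    by (simp add: power2_eq_square)
qed

section \<open>Uniform bad approximability along the geodesic\<close>

definition height_gap :: "nat \<Rightarrow> real" where
  "height_gap K = 1 / (4 * (real K + 1)\<^sup>2 * (real K + 2))"

lemma height_gap_pos: "0 < height_gap K"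
  by (simp add: height_gap_def)

text \<open>If \<open>x \<noteq> 0\<close>, the two linear forms differ by
  \<open>x * (\<alpha> + \<beta>)\<close>, of absolute value at least 1, so one of them is at least
  1/2 in size. If \<open>x = 0\<close>, the second form is the nonzero integer
  \<open>y\<close>.\<close>

lemma height_gap_short_time:
  assumes "endpoints K w \<alpha> \<beta>" "x \<in> \<int>" "y \<in> \<int>" "x \<noteq> 0 \<or> y \<noteq> 0" "1 \<le> u" "u \<le> \<beta> / \<alpha>"
  shows "height_gap K * (\<alpha> + \<beta>) \<le> u * (x * \<alpha> + y)\<^sup>2 \<or> height_gap K * (\<alpha> + \<beta>) * u \<le> (y - x * \<beta>)\<^sup>2"
proof -
  define D where "D = height_gap K * (\<alpha> + \<beta>)"
  have *: "0 < \<alpha>" "\<alpha> \<le> 1" "1 \<le> \<beta>" "\<beta> \<le> real K + 1"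
    using assms by (auto simp: endpoints_def)
  have "0 \<le> D"
    using * height_gap_pos [of K] by (simp add: D_def)
  \<comment> \<open>\<open>height_gap\<close> is chosen so that the bounds \<open>K + 2\<close> for
    \<open>\<alpha> + \<beta>\<close> and \<open>(K + 1)^2\<close> for \<open>u\<close> give exactly
    1/4 here.\<close>
  have "D * u \<le> height_gap K * (real K + 2) * (real K + 1)\<^sup>2"
    unfolding D_def using * assms(5,6) endpoints_ratio_bounds(2) [OF assms(1)] height_gap_pos [of K]
    by (intro mult_mono) auto
  also have "\<dots> = 1/4"
    by (simp add: height_gap_def add_pos_pos less_imp_neq [symmetric])
  finally have Du: "D * u \<le> 1/4" .
  have "D * 1 \<le> D * u"
    using \<open>0 \<le> D\<close> assms(5) by (intro mult_left_mono) auto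
  then have D: "D \<le> 1/4"
    using Du by simp
  show ?thesis
  proof (cases "x = 0")
    case True
    then have "1 \<le> \<bar>y\<bar>"
      using assms Ints_nonzero_abs_ge1 by blast
    then have "1 \<le> y\<^sup>2"
      using power_mono [of 1 "\<bar>y\<bar>" 2] by simp
    then show ?thesis
      using True Du by (simp add: D_def)
  next
    case False
    then have "1 \<le> \<bar>x\<bar>"
      using assms Ints_nonzero_abs_ge1 by blast
    then have "1 * 1 \<le> \<bar>x\<bar> * (\<alpha> + \<beta>)"
      using * by (intro mult_mono) auto
    also have "\<dots> = \<bar>(x * \<alpha> + y) - (y - x * \<beta>)\<bar>"
    proof -
      have "(x * \<alpha> + y) - (y - x * \<beta>) = x * (\<alpha> + \<beta>)"
        by (simp add: algebra_simps)
      then show ?thesis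
        using * by (simp only: abs_mult)
    qed
    finally have "1/2 \<le> \<bar>x * \<alpha> + y\<bar> \<or> 1/2 \<le> \<bar>y - x * \<beta>\<bar>"
      by linarith
    moreover have "1/4 \<le> z\<^sup>2" if "1/2 \<le> \<bar>z\<bar>" for z :: real
      using power_mono [OF that, of 2] by (simp add: power2_eq_square)
    ultimately have "1/4 \<le> (x * \<alpha> + y)\<^sup>2 \<or> 1/4 \<le> (y - x * \<beta>)\<^sup>2"
      by blast
    moreover have "1 * (x * \<alpha> + y)\<^sup>2 \<le> u * (x * \<alpha> + y)\<^sup>2"
      using assms(5) by (intro mult_right_mono) auto
    ultimately show ?thesis
      using D Du unfolding D_def by linarith
  qed
qed

text \<open>The time \<open>ln (\<beta> / \<alpha>)\<close> flow turns the endpoints of \<open>w\<close> into those of the rotated word;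
  here \<open>u\<close> is the exponential of the time.\<close>

lemma endpoints_badly_approximable:
  assumes "endpoints K w \<alpha> \<beta>" "x \<in> \<int>" "y \<in> \<int>" "x \<noteq> 0 \<or> y \<noteq> 0" "1 \<le> u"
  shows "height_gap K * (\<alpha> + \<beta>) \<le> u * (x * \<alpha> + y)\<^sup>2 \<or> height_gap K * (\<alpha> + \<beta>) * u \<le> (y - x * \<beta>)\<^sup>2"
proof -
  \<comment> \<open>A rotation divides \<open>u\<close> by at least this number, so an induction on
    \<open>n\<close> with \<open>u \<le> \<rho> ^ n\<close> is possible.\<close>
  define \<rho> where "\<rho> = 1 + 1 / (real K + 1)"
  have "1 < \<rho>"
    by (simp add: \<rho>_def)
  then obtain n where "u < \<rho> ^ n"
    using real_arch_pow by blast
  then have "u \<le> \<rho> ^ n"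
    by simp
  then show ?thesis
    using assms
  proof (induction n arbitrary: w \<alpha> \<beta> x y u)
    case (0 w \<alpha> \<beta> x y u)
    then have "u \<le> \<beta> / \<alpha>"
      using endpoints_ratio_bounds(1) [OF 0(2)] \<open>1 < \<rho>\<close> unfolding \<rho>_def power_0 by linarith
    then show ?case
      using height_gap_short_time 0 by blast
  next
    case (Suc n w \<alpha> \<beta> x y u)
    show ?case
    proof (cases "u \<le> \<beta> / \<alpha>")
      case True
      then show ?thesis
        using height_gap_short_time Suc.prems by blast
    next
      case False
      define D where "D = height_gap K * (\<alpha> + \<beta>)"
      define u' where "u' = u * \<alpha> / \<beta>"
      have *: "0 < \<alpha>" "0 < \<beta>"
        using Suc.prems by (auto simp: endpoints_def)
      obtain b v where w: "w = b # v"
        using Suc.prems by (cases w) (auto simp: endpoints_def)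
      have u: "u = u' * (\<beta> / \<alpha>)"
        using * by (simp add: u'_def)
      have "1 \<le> u'"
        using False * by (simp add: u'_def field_simps)
      moreover have "u' \<le> \<rho> ^ n"
      proof -
        have "u' * \<rho> \<le> u"
          unfolding u using endpoints_ratio_bounds(1) [OF Suc.prems(2)] \<open>1 \<le> u'\<close>
          by (intro mult_left_mono) (auto simp: \<rho>_def)
        also have "\<dots> \<le> \<rho> ^ n * \<rho>"
          using Suc.prems(1) by (simp add: mult.commute)
        finally show ?thesis
          using \<open>1 < \<rho>\<close> by simp
      qed
      moreover have "endpoints K (v @ [b]) (1 / \<alpha> - real b) (real b + 1 / \<beta>)"
        using endpoints_rotate Suc.prems w by blast
      \<comment> \<open>In the rotated frame the integer row \<open>(x, y)\<close> becomes
        \<open>(y, x + b * y)\<close>; its two forms are the old ones divided by \<alpha> and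
        -\<beta>.\<close>
      moreover have "x + real b * y \<in> \<int>" "y \<noteq> 0 \<or> x + real b * y \<noteq> 0"
        using Suc.prems by auto
      ultimately have IH: "height_gap K * ((1 / \<alpha> - real b) + (real b + 1 / \<beta>)) \<le> u' * (y * (1 / \<alpha> - real b) + (x + real b * y))\<^sup>2
          \<or> height_gap K * ((1 / \<alpha> - real b) + (real b + 1 / \<beta>)) * u' \<le> ((x + real b * y) - y * (real b + 1 / \<beta>))\<^sup>2"
        using Suc.prems(4) by (intro Suc.IH)
      have D': "height_gap K * ((1 / \<alpha> - real b) + (real b + 1 / \<beta>)) = D / (\<alpha> * \<beta>)"
        using * by (simp add: D_def field_simps)
      have 1: "y * (1 / \<alpha> - real b) + (x + real b * y) = (x * \<alpha> + y) / \<alpha>"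
        using * by (simp add: field_simps)
      have 2: "(x + real b * y) - y * (real b + 1 / \<beta>) = - (y - x * \<beta>) / \<beta>"
        using * by (simp add: field_simps)
      from IH show ?thesis
      proof
        assume "height_gap K * ((1 / \<alpha> - real b) + (real b + 1 / \<beta>)) \<le> u' * (y * (1 / \<alpha> - real b) + (x + real b * y))\<^sup>2"
        then have "D / (\<alpha> * \<beta>) \<le> u' * ((x * \<alpha> + y) / \<alpha>)\<^sup>2"
          unfolding D' 1 .
        then have "D / (\<alpha> * \<beta>) * (\<alpha> * \<beta>) \<le> u' * ((x * \<alpha> + y) / \<alpha>)\<^sup>2 * (\<alpha> * \<beta>)"
          using * by (intro mult_right_mono) auto
        also have "\<dots> = u * (x * \<alpha> + y)\<^sup>2"
          using * by (simp add: u power2_eq_square)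
        finally show ?thesis
          using * by (simp add: D_def)
      next
        assume "height_gap K * ((1 / \<alpha> - real b) + (real b + 1 / \<beta>)) * u' \<le> ((x + real b * y) - y * (real b + 1 / \<beta>))\<^sup>2"
        then have "D / (\<alpha> * \<beta>) * u' \<le> (- (y - x * \<beta>) / \<beta>)\<^sup>2"
          unfolding D' 2 .
        then have "D / (\<alpha> * \<beta>) * u' * \<beta>\<^sup>2 \<le> (- (y - x * \<beta>) / \<beta>)\<^sup>2 * \<beta>\<^sup>2"
          using * by (intro mult_right_mono) auto
        moreover have "(- (y - x * \<beta>) / \<beta>)\<^sup>2 * \<beta>\<^sup>2 = (y - x * \<beta>)\<^sup>2"
          using * by (simp add: power_divide power2_commute)
        moreover have "D / (\<alpha> * \<beta>) * u' * \<beta>\<^sup>2 = D * u"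
          using * by (simp add: u power2_eq_square)
        ultimately show ?thesis
          by (simp add: D_def)
      qed
    qed
  qed
qed

section \<open>The hyperbolic matrix of a word\<close>

lemma cf_mat_endpoint_mat:
  assumes "set w \<subseteq> {1..K}" "0 < \<alpha>" "0 < \<beta>"
  shows "\<exists>\<kappa> \<mu>. 1 \<le> \<kappa> \<and> (w \<noteq> [] \<longrightarrow> 1 < \<kappa>) \<and>
    cf_mat w ** endpoint_mat \<alpha> (cf_reverse w \<beta>) = endpoint_mat (cf_value w \<alpha>) \<beta> ** mat2_of \<kappa> 0 0 \<mu>"
  using assms
proof (induction w arbitrary: \<beta>)
  case (Cons b w)
  have b: "1 \<le> real b"
    using Cons.prems by auto
  have "0 < cf_value w \<alpha>"
    using cf_value_pos Cons.prems by blast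
  obtain \<kappa> \<mu> where IH: "1 \<le> \<kappa>"
    "cf_mat w ** endpoint_mat \<alpha> (cf_reverse w (real b + 1 / \<beta>)) = endpoint_mat (cf_value w \<alpha>) (real b + 1 / \<beta>) ** mat2_of \<kappa> 0 0 \<mu>"
    using Cons.IH [of "real b + 1 / \<beta>"] Cons.prems by (auto simp: add_nonneg_pos)
  \<comment> \<open>A digit matrix carries one endpoint frame to the next up to a diagonal factor.
    The first diagonal entry exceeds 1, and these entries multiply along the word.\<close>
  have "mat2_of 0 1 1 (real b) ** endpoint_mat (cf_value w \<alpha>) (real b + 1 / \<beta>) =
      endpoint_mat (1 / (real b + cf_value w \<alpha>)) \<beta> ** mat2_of (real b + cf_value w \<alpha>) 0 0 (- 1 / \<beta>)"
    using b \<open>0 < cf_value w \<alpha>\<close> Cons.prems by (simp add: endpoint_mat_def)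
  then have "cf_mat (b # w) ** endpoint_mat \<alpha> (cf_reverse (b # w) \<beta>) =
      endpoint_mat (cf_value (b # w) \<alpha>) \<beta> ** (mat2_of (real b + cf_value w \<alpha>) 0 0 (- 1 / \<beta>) ** mat2_of \<kappa> 0 0 \<mu>)"
    using IH(2) by (simp add: matrix_mul_assoc [symmetric] del: mat2_of_mult) (simp add: matrix_mul_assoc del: mat2_of_mult)
  moreover have "1 * 1 < (real b + cf_value w \<alpha>) * \<kappa>"
    using b \<open>0 < cf_value w \<alpha>\<close> IH(1) by (intro mult_less_le_imp_less) auto
  ultimately show ?case
    by (intro exI [of _ "(real b + cf_value w \<alpha>) * \<kappa>", OF exI [of _ "- 1 / \<beta> * \<mu>"]]) auto
qed (auto intro!: exI [of _ 1] simp flip: mat_1_mat2_of)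

lemma det_cf_mat: "det (cf_mat w) = (-1) ^ length w"
  by (induction w) (auto simp: det_mul)

lemma cf_mat_GL2Z: "cf_mat w \<in> GL2Z"
  by (induction w) (auto intro!: GL2Z_mult simp: GL2Z_mat2_of)

text \<open>Reading the digits multiplies the row \<open>(c, d)\<close> by \<open>cf_mat w\<close>;
  the weight is then \<open>d * (c + d)\<close> at the resulting row.\<close>

lemma wt_cf_mat: "wt w c d = (c * cf_mat w$1$2 + d * cf_mat w$2$2) *
    ((c * cf_mat w$1$1 + d * cf_mat w$2$1) + (c * cf_mat w$1$2 + d * cf_mat w$2$2))"
proof (induction w arbitrary: c d)
  case (Cons b w)
  have "cf_mat (b # w) = mat2_of 0 1 1 (real b) ** mat2_of (cf_mat w$1$1) (cf_mat w$1$2) (cf_mat w$2$1) (cf_mat w$2$2)"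
    using mat2_of_eta [of "cf_mat w"] by simp
  then show ?case
    by (simp only: wt.simps Cons mat2_of_mult mat2_of_nth) (simp add: algebra_simps)
qed (simp add: mat_1_mat2_of)

text \<open>The comparison of column sums carries the induction, since a new digit makes the bottom
  row \<open>(p + b * r, q + b * s)\<close>.\<close>

lemma cf_mat_entries:
  assumes "set w \<subseteq> {1..K}"
  shows "0 \<le> cf_mat w$1$1 \<and> 0 \<le> cf_mat w$1$2 \<and> 0 \<le> cf_mat w$2$1 \<and> 0 \<le> cf_mat w$2$2 \<and>
    cf_mat w$1$1 \<le> cf_mat w$2$2 \<and> cf_mat w$2$1 \<le> cf_mat w$2$2 \<and>
    cf_mat w$1$1 + cf_mat w$2$1 \<le> cf_mat w$1$2 + cf_mat w$2$2"
  using assms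
proof (induction w)
  case (Cons b w)
  obtain p q r s where pqrs: "cf_mat w = mat2_of p q r s"
    using mat2_of_eta by blast
  have b: "1 \<le> real b"
    using Cons.prems by auto
  have *: "0 \<le> p" "0 \<le> q" "0 \<le> r" "0 \<le> s" "p \<le> s" "r \<le> s" "p + r \<le> q + s"
    using Cons by (auto simp: pqrs)
  have "(real b - 1) * r \<le> (real b - 1) * s"
    using b * by (intro mult_left_mono) auto
  then have "p + real b * r \<le> q + real b * s"
    using * by (simp add: algebra_simps)
  moreover have "1 * s \<le> real b * s"
    using b * by (intro mult_right_mono) auto
  moreover have "0 \<le> real b * r" "0 \<le> real b * s"
    using b * by auto
  ultimately show ?case
    using * by (simp add: pqrs)
qed (simp add: mat_1_mat2_of)

lemma trace_cf_mat_square_le: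
  assumes "set w \<subseteq> {1..K}"
  shows "(trace (cf_mat w))\<^sup>2 \<le> 4 * wt w 0 1"
proof -
  let ?s = "cf_mat w $ 2 $ 2"
  have *: "0 \<le> trace (cf_mat w)" "trace (cf_mat w) \<le> 2 * ?s" "0 \<le> ?s" "0 \<le> cf_mat w $ 2 $ 1"
    using cf_mat_entries [OF assms] by (simp_all add: trace_def sum_2)
  then have "(trace (cf_mat w))\<^sup>2 \<le> (2 * ?s)\<^sup>2"
    by (intro power_mono)
  also have "\<dots> \<le> 4 * wt w 0 1"
    using * by (simp add: wt_cf_mat power2_eq_square distrib_left)
  finally show ?thesis .
qed

text \<open>Even length makes the determinant 1, so the diagonal factor has entries \<kappa> and
  1/\<kappa> and equals \<open>aH t\<close> with \<open>t = 2 * ln \<kappa>\<close>.\<close>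

lemma cf_mat_hyperbolic:
  assumes ends: "endpoints K w \<alpha> \<beta>" and "even (length w)"
  shows "\<exists>t>0. cf_mat w ** endpoint_mat \<alpha> \<beta> = endpoint_mat \<alpha> \<beta> ** aH t \<and> trace (cf_mat w) = exp (t/2) + exp (-t/2)"
proof -
  have *: "w \<noteq> []" "set w \<subseteq> {1..K}" "0 < \<alpha>" "0 < \<beta>" "cf_value w \<alpha> = \<alpha>" "cf_reverse w \<beta> = \<beta>"
    using ends by (auto simp: endpoints_def)
  obtain \<kappa> \<mu> where \<kappa>: "1 < \<kappa>" and eq: "cf_mat w ** endpoint_mat \<alpha> \<beta> = endpoint_mat \<alpha> \<beta> ** mat2_of \<kappa> 0 0 \<mu>"
    using cf_mat_endpoint_mat [OF *(2-4)] * by auto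
  have "det (cf_mat w ** endpoint_mat \<alpha> \<beta>) = \<alpha> + \<beta>"
    using assms by (simp add: det_mul det_cf_mat)
  moreover have "det (endpoint_mat \<alpha> \<beta> ** mat2_of \<kappa> 0 0 \<mu>) = (\<alpha> + \<beta>) * (\<kappa> * \<mu>)"
    by (simp only: det_mul det_endpoint_mat det_mat2_of) simp
  ultimately have "\<kappa> * \<mu> = 1"
    using eq * by simp
  then have \<mu>: "\<mu> = 1 / \<kappa>"
    using \<kappa> by (simp add: field_simps)
  define t where "t = 2 * ln \<kappa>"
  have "t / 2 = ln \<kappa>" "- t / 2 = - ln \<kappa>"
    by (simp_all add: t_def)
  then have exps: "exp (t/2) = \<kappa>" "exp (-t/2) = \<mu>"
    using \<kappa> by (simp_all only: \<mu> exp_minus) (simp_all add: inverse_eq_divide)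
  then have aH: "aH t = mat2_of \<kappa> 0 0 \<mu>"
    by (simp add: aH_mat2_of)
  obtain p q r s where pqrs: "cf_mat w = mat2_of p q r s"
    using mat2_of_eta by blast
  have e: "p * \<alpha> + q = \<alpha> * \<kappa>" "r * \<alpha> + s = \<kappa>" "q - p * \<beta> = - \<beta> * \<mu>" "s - r * \<beta> = \<mu>"
    using eq by (auto simp: pqrs endpoint_mat_def)
  \<comment> \<open>The trace is the sum of the eigenvalues, by elimination from the eigenvector
    equations for the two columns.\<close>
  have "(p + s - (\<kappa> + \<mu>)) * (\<alpha> + \<beta>) = 0"
    using e by algebra
  then have "trace (cf_mat w) = \<kappa> + \<mu>"
    using * by (simp add: pqrs)
  moreover have "0 < t"
    using \<kappa> by (simp add: t_def)
  ultimately show ?thesis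
    using eq aH exps by metis
qed

section \<open>Periodic orbits\<close>

lemma GL2R_inverse:
  assumes "g \<in> GL2R"
  shows "g ** matrix_inv g = mat 1" "matrix_inv g ** g = mat 1"
proof -
  have "\<exists>A'. g ** A' = mat 1 \<and> A' ** g = mat 1"
    using assms by (simp add: GL2R_def invertible_det_nz [symmetric] invertible_def)
  then have "g ** matrix_inv g = mat 1 \<and> matrix_inv g ** g = mat 1"
    unfolding matrix_inv_def by (rule someI_ex)
  then show "g ** matrix_inv g = mat 1" "matrix_inv g ** g = mat 1"
    by auto
qed

lemma trace_mult_commute: "trace (A ** B) = trace (B ** A)" for A B :: mat2
  by (simp add: trace_def matrix_matrix_mult_def sum_2 algebra_simps)

lemma cls_aH_cong: "cls g = cls h \<Longrightarrow> cls (g ** aH t) = cls (h ** aH t)"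
  unfolding cls_eq_iff by (rule cls_mult_right)

lemma cls_aH_shift: "cls (g ** aH s) = cls (h ** aH t) \<Longrightarrow> cls (g ** aH (s + u)) = cls (h ** aH (t + u))"
  using cls_aH_cong [of "g ** aH s" "h ** aH t" u] by (simp add: aH_add flip: matrix_mul_assoc)

lemma Horbit_eq: "Horbit g = range (\<lambda>t. cls (g ** aH t))"
  by (auto simp: Horbit_def)

lemma cls_in_Horbit: "cls g \<in> Horbit g"
  unfolding Horbit_eq by (rule range_eqI [of _ _ 0]) simp

lemma cls_aH_int_period:
  assumes "cls (g ** aH T) = cls g"
  shows "cls (g ** aH (t + of_int k * T)) = cls (g ** aH t)"
proof -
  have step: "cls (g ** aH (t + T)) = cls (g ** aH t)" for t
    using cls_aH_shift [of g T g 0 t] assms by (simp add: add.commute)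
  have nat: "cls (g ** aH (t + real n * T)) = cls (g ** aH t)" for t n
  proof (induction n)
    case (Suc n)
    then show ?case
      using step [of "t + real n * T"] by (simp add: algebra_simps)
  qed simp
  show ?thesis
  proof (cases "0 \<le> k")
    case True
    then show ?thesis
      using nat [of t "nat k"] by simp
  next
    case False
    then show ?thesis
      using nat [of "t + of_int k * T" "nat (- k)"] by simp
  qed
qed

lemma cls_aH_reduce:
  assumes "cls (g ** aH T) = cls g" "0 < T"
  obtains t' where "0 \<le> t'" "t' < T" "cls (g ** aH t) = cls (g ** aH t')"
proof
  define t' where "t' = t + of_int (- \<lfloor>t / T\<rfloor>) * T"
  have "of_int \<lfloor>t / T\<rfloor> * T \<le> t" "t < (of_int \<lfloor>t / T\<rfloor> + 1) * T"
    using assms(2) by (simp_all add: pos_le_divide_eq [symmetric] pos_divide_less_eq [symmetric])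
  then show "0 \<le> t'" "t' < T"
    by (simp_all add: t'_def algebra_simps)
  show "cls (g ** aH t) = cls (g ** aH t')"
    unfolding t'_def using cls_aH_int_period [OF assms(1)] by metis
qed

lemma cls_aH_period:
  assumes "\<gamma> \<in> GL2Z" "\<gamma> ** g = g ** aH T"
  shows "cls (g ** aH T) = cls g"
  unfolding cls_eq_iff cls_iff by (rule exI [of _ 1], rule exI [of _ \<gamma>]) (simp add: assms)

text \<open>The orbit is the continuous image of the compact interval \<open>{0..T}\<close>.\<close>

lemma periodic_Horbit:
  assumes "g \<in> GL2R" "cls (g ** aH T) = cls g" "0 < T"
  shows "periodic (Horbit g)"
proof -
  have "Horbit g = (\<lambda>t. cls (g ** aH t)) ` {0..T}"
  proof
    show "Horbit g \<subseteq> (\<lambda>t. cls (g ** aH t)) ` {0..T}"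
    proof
      fix p assume "p \<in> Horbit g"
      then obtain t where "p = cls (g ** aH t)"
        by (auto simp: Horbit_eq)
      then show "p \<in> (\<lambda>t. cls (g ** aH t)) ` {0..T}"
        using cls_aH_reduce [OF assms(2,3), of t] by (metis atLeastAtMost_iff imageI less_imp_le)
    qed
  qed (auto simp: Horbit_eq)
  moreover have "compactin Xtop ((\<lambda>t. cls (g ** aH t)) ` {0..T})"
    by (rule image_compactin [OF _ continuous_map_cls_aH [OF assms(1)]]) simp
  ultimately show ?thesis
    using assms(1) by (auto simp: periodic_def Horbits_def)
qed

text \<open>A closed geodesic comes from an integer matrix of determinant \<open>\<plusminus>1\<close> whose trace has
  absolute value \<open>2 cosh (t/2) > 2\<close>, hence at least \<open>3\<close>.\<close>

lemma period_ge_1: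
  assumes g: "g \<in> GL2R" and "0 < t" and eq: "cls (g ** aH t) = cls g"
  shows "1 \<le> t"
proof (rule ccontr)
  assume "\<not> 1 \<le> t"
  obtain r \<sigma> where r: "r \<noteq> 0" and \<sigma>: "\<sigma> \<in> GL2Z" and *: "g ** aH t = r *\<^sub>R (\<sigma> ** g)"
    using eq cls_eq_iff cls_iff by metis
  have "det g = r\<^sup>2 * det \<sigma> * det g"
    using arg_cong [OF *, of det] by (simp add: det_mul det_scaleR_mat2)
  then have "r\<^sup>2 * det \<sigma> = 1"
    using g by (simp add: GL2R_def)
  then have "\<bar>r\<^sup>2 * det \<sigma>\<bar> = 1"
    by simp
  then have "r\<^sup>2 = 1"
    using \<sigma> by (simp add: GL2Z_def abs_mult)
  then have "\<bar>r\<bar> = 1"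
    by (auto simp: power2_eq_1_iff)
  have "trace (aH t) = trace (matrix_inv g ** (g ** aH t))"
    using GL2R_inverse [OF g] by (simp add: matrix_mul_assoc)
  also have "\<dots> = r * trace (matrix_inv g ** (\<sigma> ** g))"
    unfolding * scaleR_matrix_mult by (simp add: trace_def sum_2 distrib_left)
  also have "trace (matrix_inv g ** (\<sigma> ** g)) = trace (\<sigma> ** (g ** matrix_inv g))"
    by (subst trace_mult_commute) (simp add: matrix_mul_assoc)
  also have "\<dots> = trace \<sigma>"
    using GL2R_inverse [OF g] by simp
  finally have "\<bar>trace (aH t)\<bar> = \<bar>trace \<sigma>\<bar>"
    using \<open>\<bar>r\<bar> = 1\<close> by (simp add: abs_mult)
  moreover define e where "e = exp (t/2)"
  \<comment> \<open>From \<open>t < 1\<close> follows exp t < exp 1 \<le> 3 < 4. Together with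
    \<open>1 / e < 1\<close> this puts the absolute trace strictly between 2 and 3.\<close>
  have "e < 2"
  proof -
    have "exp t < exp (1::real)"
      using \<open>\<not> 1 \<le> t\<close> by simp
    then have "exp t < 2\<^sup>2"
      using exp_le by (simp only: power2_eq_square)
    then have "e\<^sup>2 < 2\<^sup>2"
      by (simp only: e_def exp_double [symmetric]) simp
    then show ?thesis
      by (rule power_less_imp_less_base) simp
  qed
  have "1 < e"
    using \<open>0 < t\<close> by (simp add: e_def)
  have "trace (aH t) = e + 1 / e"
    by (simp add: aH_mat2_of e_def exp_minus inverse_eq_divide)
  moreover have "0 < (e - 1)\<^sup>2"
    using \<open>1 < e\<close> by simp
  then have "2 < e + 1 / e"
    using \<open>1 < e\<close> by (simp add: field_simps power2_eq_square)
  moreover have "1 / e < 1"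
    using \<open>1 < e\<close> by simp
  ultimately have "2 < \<bar>trace \<sigma>\<bar>" "\<bar>trace \<sigma>\<bar> < 3"
    using \<open>e < 2\<close> by linarith+
  moreover have "\<bar>trace \<sigma>\<bar> \<in> \<int>"
    using \<sigma> by (auto simp: trace_def sum_2 GL2Z_def)
  then obtain k :: int where "\<bar>trace \<sigma>\<bar> = of_int k"
    by (auto elim: Ints_cases)
  ultimately have "2 < k" "k < 3"
    by simp_all
  then show False
    by simp
qed

text \<open>The infimum runs over a nonempty set, as it contains \<open>T\<close>, and all its
  members are periods, hence at least 1.\<close>

lemma orbit_vol_ge_1:
  assumes g: "g \<in> GL2R" and T: "cls (g ** aH T) = cls g" "0 < T"
  shows "1 \<le> orbit_vol (Horbit g)"
  unfolding orbit_vol_def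
proof (rule cInf_greatest)
  have "cls (k ** aH T) = cls k" if "cls k \<in> Horbit g" for k
  proof -
    obtain t where t: "cls k = cls (g ** aH t)"
      using \<open>cls k \<in> Horbit g\<close> by (auto simp: Horbit_eq)
    then have "cls (k ** aH T) = cls (g ** aH (t + T))"
      using cls_aH_shift [of k 0 g t T] by simp
    also have "\<dots> = cls (g ** aH t)"
      using cls_aH_int_period [OF T(1), of t 1] by simp
    finally show ?thesis
      using t by simp
  qed
  then show "{t. 0 < t \<and> (\<forall>k\<in>GL2R. cls k \<in> Horbit g \<longrightarrow> cls (k ** aH t) = cls k)} \<noteq> {}"
    using T(2) by auto
next
  fix t assume "t \<in> {t. 0 < t \<and> (\<forall>k\<in>GL2R. cls k \<in> Horbit g \<longrightarrow> cls (k ** aH t) = cls k)}"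
  then show "1 \<le> t"
    using period_ge_1 [OF g] g cls_in_Horbit by blast
qed

lemma in_HorbitE:
  assumes "cls k \<in> Horbit g"
  obtains t r \<sigma> where "r \<noteq> 0" "\<sigma> \<in> GL2Z" "k = r *\<^sub>R (\<sigma> ** (g ** aH t))"
proof -
  obtain t where "cls k = cls (g ** aH t)"
    using assms by (auto simp: Horbit_eq)
  then show ?thesis
    using that unfolding cls_eq_iff cls_iff by blast
qed

section \<open>Discriminants bounded by traces\<close>

lemma disc_of_le:
  assumes g: "g \<in> GL2R" and Z: "\<forall>i j. Z $ i $ j \<in> \<int>" "Z ** g = g ** aH T" and T: "0 < T"
  shows "disc_of g \<le> 4 * (trace Z)\<^sup>2"
proof -
  define A where "A = g ** Dh ** matrix_inv g"
  define s where "s = (exp (T/2) - exp (-T/2)) / 2"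
  define c where "c = (exp (T/2) + exp (-T/2)) / 2"
  \<comment> \<open>Here \<open>s\<close> and \<open>c\<close> are sinh(T/2) and cosh(T/2).
    Conjugated by \<open>g\<close>, the identity shows that \<open>s\<close> is a coefficient of the
    integral lattice, so the generator has \<open>s0 \<le> s\<close>.\<close>
  have aH: "aH T = s *\<^sub>R Dh + c *\<^sub>R mat 1"
    by (simp add: aH_mat2_of Dh_mat2_of mat_1_mat2_of s_def c_def diff_divide_distrib add_divide_distrib)
  have "Z = (Z ** g) ** matrix_inv g"
    using GL2R_inverse [OF g] by (simp add: matrix_mul_assoc [symmetric])
  also have "\<dots> = g ** (s *\<^sub>R Dh + c *\<^sub>R mat 1) ** matrix_inv g"
    by (simp only: Z(2) aH)
  also have "\<dots> = s *\<^sub>R A + c *\<^sub>R (g ** matrix_inv g)"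
    by (simp add: A_def mat2_eq_iff matrix_matrix_mult_def sum_2 mat_def algebra_simps)
  also have "\<dots> = s *\<^sub>R A + c *\<^sub>R mat 1"
    using GL2R_inverse [OF g] by simp
  finally have ZA: "Z = s *\<^sub>R A + c *\<^sub>R mat 1" .
  have "0 < s"
    using T by (simp add: s_def)
  then have s: "s \<in> {s \<in> lat_coeffs g. s > 0}"
    using ZA Z(1) unfolding lat_coeffs_def A_def by blast
  define s0 where "s0 = Inf {s \<in> lat_coeffs g. s > 0}"
  have "s0 \<le> s"
    unfolding s0_def using s by (intro cInf_lower) (auto intro!: bdd_belowI [of _ 0])
  have "0 \<le> s0"
    unfolding s0_def using s by (intro cInf_greatest) auto
  have "A ** A = g ** Dh ** (matrix_inv g ** g) ** Dh ** matrix_inv g"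
    by (simp add: A_def matrix_mul_assoc)
  also have "\<dots> = g ** (Dh ** Dh) ** matrix_inv g"
    using GL2R_inverse [OF g] by (simp add: matrix_mul_assoc)
  also have "Dh ** Dh = mat 1"
    by (simp add: Dh_mat2_of mat_1_mat2_of)
  finally have AA: "A ** A = mat 1"
    using GL2R_inverse [OF g] by simp
  have "trace A = trace (matrix_inv g ** (g ** Dh))"
    unfolding A_def by (rule trace_mult_commute)
  also have "\<dots> = 0"
    using GL2R_inverse [OF g] by (simp add: matrix_mul_assoc Dh_mat2_of)
  finally have tr: "trace A = 0" .
  have trs: "trace (r *\<^sub>R B) = r * trace B" for r and B :: mat2
    by (simp add: trace_def sum_2 distrib_left)
  have tr1: "trace (mat 1 :: mat2) = 2"
    by (simp add: mat_1_mat2_of)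
  \<comment> \<open>\<open>A\<close> is traceless with square 1, and \<open>trL (mat 1) = 4\<close>,
    so \<open>Bform\<close> takes the value 4 * 4 at \<open>A\<close>.\<close>
  have "disc_of g = 16 * s0\<^sup>2"
    unfolding disc_of_def Let_def s0_def [symmetric] A_def [symmetric] Bform_def trL_def
    by (simp add: scaleR_matrix_mult AA tr trs tr1 power2_eq_square)
  also have "\<dots> \<le> 16 * c\<^sup>2"
  proof -
    have "s \<le> c"
      by (simp add: s_def c_def)
    then show ?thesis
      using \<open>s0 \<le> s\<close> \<open>0 \<le> s0\<close> by (simp add: power_mono)
  qed
  also have "trace Z = 2 * c"
    using trs [of s A] trs [of c "mat 1"] unfolding ZA by (simp add: trace_add tr tr1)
  then have "16 * c\<^sup>2 = 4 * (trace Z)\<^sup>2"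
    by simp
  finally show ?thesis .
qed

text \<open>The representative chosen by \<open>orbit_disc\<close> is arbitrary, but it has the form
  r \<sigma> h a_t. Conjugating \<gamma> by \<sigma> gives an integral matrix with the same trace
  that serves this representative.\<close>

lemma orbit_disc_le:
  assumes h: "h \<in> GL2R" and \<gamma>: "\<gamma> \<in> GL2Z" "\<gamma> ** h = h ** aH T" and T: "0 < T"
  shows "orbit_disc (Horbit h) \<le> 4 * (trace \<gamma>)\<^sup>2"
proof -
  define g where "g = (SOME g. g \<in> GL2R \<and> Horbit h = Horbit g)"
  have "g \<in> GL2R \<and> Horbit h = Horbit g"
    unfolding g_def by (rule someI [of _ h]) (simp add: h)
  then have g: "g \<in> GL2R" "cls g \<in> Horbit h"
    using cls_in_Horbit by auto
  obtain t r \<sigma> where *: "r \<noteq> 0" "\<sigma> \<in> GL2Z" "g = r *\<^sub>R (\<sigma> ** (h ** aH t))"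
    using g(2) by (rule in_HorbitE)
  obtain \<tau> where \<tau>: "\<tau> \<in> GL2Z" "\<tau> ** \<sigma> = mat 1"
    using GL2Z_inverse [OF *(2)] by metis
  define Z where "Z = \<sigma> ** \<gamma> ** \<tau>"
  have "Z ** g = r *\<^sub>R (\<sigma> ** \<gamma> ** (\<tau> ** \<sigma>) ** (h ** aH t))"
    by (simp add: Z_def *(3) scaleR_matrix_mult matrix_mul_assoc)
  also have "\<dots> = r *\<^sub>R (\<sigma> ** (\<gamma> ** h) ** aH t)"
    by (simp add: \<tau> matrix_mul_assoc)
  also have "\<dots> = r *\<^sub>R (\<sigma> ** h ** (aH T ** aH t))"
    by (simp add: \<gamma> matrix_mul_assoc)
  also have "\<dots> = g ** aH T"
    by (simp add: *(3) aH_add scaleR_matrix_mult matrix_mul_assoc [symmetric] add.commute)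
  finally have "Z ** g = g ** aH T" .
  moreover have "Z \<in> GL2Z"
    using * \<tau> \<gamma> by (simp add: Z_def GL2Z_mult)
  ultimately have "disc_of g \<le> 4 * (trace Z)\<^sup>2"
    using g T by (intro disc_of_le) (auto simp: GL2Z_def)
  moreover have "trace Z = trace (\<tau> ** (\<sigma> ** \<gamma>))"
    unfolding Z_def by (rule trace_mult_commute)
  then have "trace Z = trace \<gamma>"
    by (simp add: matrix_mul_assoc \<tau>)
  ultimately show ?thesis
    by (simp add: orbit_disc_def g_def)
qed

lemma endpoint_mat_GL2R: "endpoints K w \<alpha> \<beta> \<Longrightarrow> endpoint_mat \<alpha> \<beta> \<in> GL2R"
  by (auto simp: endpoints_def GL2R_def)

text \<open>By periodicity only times \<open>t \<ge> 0\<close> matter. There the squared coordinates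
  of a lattice vector are the two quantities in \<open>endpoints_badly_approximable\<close> for
  \<open>u = exp t\<close>, the second one divided by \<open>u\<close>.\<close>

lemma Horbit_subset_Omega':
  assumes ends: "endpoints K w \<alpha> \<beta>" and T: "cls (endpoint_mat \<alpha> \<beta> ** aH T) = cls (endpoint_mat \<alpha> \<beta>)" "0 < T"
  shows "Horbit (endpoint_mat \<alpha> \<beta>) \<subseteq> Omega' (height_gap K)"
proof
  fix p assume "p \<in> Horbit (endpoint_mat \<alpha> \<beta>)"
  then obtain t where "0 \<le> t" and p: "p = cls (endpoint_mat \<alpha> \<beta> ** aH t)"
    using cls_aH_reduce [OF T] by (metis (no_types, lifting) Horbit_eq imageE)
  have *: "0 < \<alpha>" "0 < \<beta>"
    using ends by (auto simp: endpoints_def)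
  have "height_gap K * \<bar>det (endpoint_mat \<alpha> \<beta> ** aH t)\<bar> \<le> (supnorm2 (m v* (endpoint_mat \<alpha> \<beta> ** aH t)))\<^sup>2"
    if m: "\<forall>i. m $ i \<in> \<int>" "m \<noteq> 0" for m :: "real^2"
  proof -
    define x y where "x = m $ 1" and "y = m $ 2"
    have xy: "x \<in> \<int>" "y \<in> \<int>" "x \<noteq> 0 \<or> y \<noteq> 0"
      using m by (auto simp: x_def y_def vec_eq_iff forall_2)
    let ?v = "m v* (endpoint_mat \<alpha> \<beta> ** aH t)"
    have v1: "?v $ 1 = exp (t/2) * (x * \<alpha> + y)" and v2: "?v $ 2 = exp (-t/2) * (y - x * \<beta>)"
      by (simp_all add: vector_matrix_mult_def sum_2 endpoint_mat_def aH_mat2_of x_def y_def algebra_simps)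
    have e: "(exp (t/2))\<^sup>2 = exp t" "(exp (-t/2))\<^sup>2 = exp (-t)"
      by (simp_all add: exp_double [symmetric])
    have sq: "(?v $ i)\<^sup>2 \<le> (supnorm2 ?v)\<^sup>2" for i
      using exhaust_2 [of i] by (auto simp: supnorm2_def intro!: abs_le_square_iff [THEN iffD1])
    have det: "\<bar>det (endpoint_mat \<alpha> \<beta> ** aH t)\<bar> = \<alpha> + \<beta>"
      using * by (simp add: det_mul)
    from endpoints_badly_approximable [OF ends xy, of "exp t"] \<open>0 \<le> t\<close>
    have "height_gap K * (\<alpha> + \<beta>) \<le> exp t * (x * \<alpha> + y)\<^sup>2 \<or> height_gap K * (\<alpha> + \<beta>) * exp t \<le> (y - x * \<beta>)\<^sup>2"
      by simp
    then show ?thesis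
    proof
      assume "height_gap K * (\<alpha> + \<beta>) \<le> exp t * (x * \<alpha> + y)\<^sup>2"
      also have "\<dots> = (?v $ 1)\<^sup>2"
        unfolding v1 power_mult_distrib e ..
      finally show ?thesis
        unfolding det using sq order_trans by blast
    next
      assume "height_gap K * (\<alpha> + \<beta>) * exp t \<le> (y - x * \<beta>)\<^sup>2"
      then have "height_gap K * (\<alpha> + \<beta>) * exp t * exp (-t) \<le> (y - x * \<beta>)\<^sup>2 * exp (-t)"
        by (intro mult_right_mono) auto
      moreover have "exp t * exp (-t) = 1"
        by (simp add: exp_minus)
      ultimately have "height_gap K * (\<alpha> + \<beta>) \<le> exp (-t) * (y - x * \<beta>)\<^sup>2"
        by (metis mult.assoc mult.commute mult_1_right)
      also have "\<dots> = (?v $ 2)\<^sup>2"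
        unfolding v2 power_mult_distrib e ..
      finally show ?thesis
        unfolding det using sq order_trans by blast
    qed
  qed
  then show "p \<in> Omega' (height_gap K)"
    unfolding Omega'_def p using GL2R_aH endpoint_mat_GL2R [OF ends] by blast
qed

section \<open>Words sharing an orbit\<close>

lemma exp_half_le_2: "exp (1/2) \<le> (2::real)"
proof (rule power2_le_imp_le)
  show "(exp (1/2))\<^sup>2 \<le> (2::real)\<^sup>2"
    using exp_le by (simp add: exp_double [symmetric])
qed simp

lemma endpoints_less_1: "endpoints K w \<alpha> \<beta> \<Longrightarrow> \<alpha> < 1"
proof -
  assume ends: "endpoints K w \<alpha> \<beta>"
  obtain b v where w: "w = b # v"
    using ends by (cases w) (auto simp: endpoints_def)
  then have "0 < 1 / \<alpha> - real b" "1 \<le> b" "0 < \<alpha>"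
    using endpoints_rotate ends by (auto simp: endpoints_def)
  then have "1 < 1 / \<alpha>"
    by linarith
  then show ?thesis
    using \<open>0 < \<alpha>\<close> by simp
qed

text \<open>Tails lie strictly between 0 and 1, so each digit is the integer part of a reciprocal
  and can be read off.\<close>

lemma cf_value_inj:
  assumes "length v = length w" "0 \<notin> set v" "0 \<notin> set w" "0 < x" "x < 1" "0 < y" "y < 1"
    and "cf_value v x = cf_value w y"
  shows "v = w"
  using assms
proof (induction v w rule: list_induct2)
  case (Cons b v b' w)
  have fwd01: "0 < cf_value u z \<and> cf_value u z < 1" if "0 \<notin> set u" "0 < z" "z < 1" for u z
    using that
  proof (induction u)
    case (Cons b u)
    then have "1 < real b + cf_value u z"
      by (cases b) auto
    then show ?case
      by simp
  qed simp
  have f: "0 < cf_value v x" "cf_value v x < 1" "0 < cf_value w y" "cf_value w y < 1"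
    using fwd01 Cons.prems by auto
  have "real b + cf_value v x = real b' + cf_value w y"
    using Cons.prems f by (simp add: field_simps)
  moreover then have "b = b'"
    using f by linarith
  ultimately show ?case
    using Cons by simp
qed simp

lemma GL2Z_matrix_inv:
  assumes "\<sigma> \<in> GL2Z"
  shows "matrix_inv \<sigma> \<in> GL2Z" "matrix_inv \<sigma> ** \<sigma> = mat 1"
proof -
  have *: "\<sigma> ** matrix_inv \<sigma> = mat 1" "matrix_inv \<sigma> ** \<sigma> = mat 1"
    using GL2R_inverse [of \<sigma>] assms by (auto simp: GL2R_def GL2Z_def)
  obtain \<tau> where \<tau>: "\<tau> \<in> GL2Z" "\<tau> ** \<sigma> = mat 1"
    using GL2Z_inverse [OF assms] by metis
  have "\<tau> = (\<tau> ** \<sigma>) ** matrix_inv \<sigma>"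
    using *(1) by (simp add: matrix_mul_assoc [symmetric])
  then show "matrix_inv \<sigma> \<in> GL2Z" "matrix_inv \<sigma> ** \<sigma> = mat 1"
    using \<tau> * by simp_all
qed

definition bounded_int_mats :: "real \<Rightarrow> mat2 set" where
  "bounded_int_mats C = {N. \<forall>i j. N $ i $ j \<in> \<int> \<and> \<bar>N $ i $ j\<bar> \<le> C}"

lemma finite_bounded_int_mats: "finite (bounded_int_mats C)"
proof -
  let ?I = "{x::real. x \<in> \<int> \<and> \<bar>x\<bar> \<le> C}"
  have "bounded_int_mats C \<subseteq> (\<lambda>(a, b, c, d). mat2_of a b c d) ` (?I \<times> ?I \<times> ?I \<times> ?I)"
  proof
    fix N assume "N \<in> bounded_int_mats C"
    then show "N \<in> (\<lambda>(a, b, c, d). mat2_of a b c d) ` (?I \<times> ?I \<times> ?I \<times> ?I)"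
      using mat2_of_eta [of N] by (intro image_eqI [of _ _ "(N$1$1, N$1$2, N$2$1, N$2$2)"]) (auto simp: bounded_int_mats_def)
  qed
  moreover have "finite ?I"
    using finite_abs_int_segment [of C] by simp
  ultimately show ?thesis
    by (meson finite_SigmaI finite_imageI finite_subset)
qed

text \<open>Both frames have bounded entries and determinant at least 1, and \<open>aH x\<close> is
  bounded. Comparing determinants bounds \<open>c\<close>, hence the right-hand side and then
  \<open>N\<close>.\<close>

lemma change_of_endpoints_bounded:
  assumes N: "N \<in> GL2Z" and ends: "endpoints K w \<alpha> \<beta>" "endpoints K w' \<alpha>' \<beta>'"
    and x: "\<bar>x\<bar> \<le> 1" and eq: "N ** endpoint_mat \<alpha> \<beta> = c *\<^sub>R (endpoint_mat \<alpha>' \<beta>' ** aH x)"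
  shows "N \<in> bounded_int_mats (6 * (real K + 2)\<^sup>2)"
proof -
  have ab: "0 < \<alpha>" "\<alpha> \<le> 1" "1 \<le> \<beta>" "\<beta> \<le> real K + 1" "0 < \<alpha>'" "\<alpha>' \<le> 1" "1 \<le> \<beta>'" "\<beta>' \<le> real K + 1"
    using ends by (auto simp: endpoints_def)
  define k where "k = real K + 2"
  have k: "2 \<le> k" "\<alpha> + \<beta> \<le> k" "\<beta>' \<le> k"
    using ab by (auto simp: k_def)
  have "det N * (\<alpha> + \<beta>) = c\<^sup>2 * (\<alpha>' + \<beta>')"
    using arg_cong [OF eq, of det] by (simp add: det_mul det_scaleR_mat2)
  then have "\<bar>det N\<bar> * \<bar>\<alpha> + \<beta>\<bar> = \<bar>c\<^sup>2 * (\<alpha>' + \<beta>')\<bar>"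
    by (metis abs_mult)
  then have "\<alpha> + \<beta> = c\<^sup>2 * (\<alpha>' + \<beta>')"
    using N ab by (simp add: GL2Z_def)
  moreover have "c\<^sup>2 * 1 \<le> c\<^sup>2 * (\<alpha>' + \<beta>')"
    using ab by (intro mult_left_mono) auto
  ultimately have "c\<^sup>2 \<le> k"
    using k by linarith
  also have "\<dots> \<le> k\<^sup>2"
    using k by (simp add: power2_eq_square)
  finally have c: "\<bar>c\<bar> \<le> k"
    using k by (simp add: abs_le_square_iff [symmetric])
  obtain p q r s where N_eq: "N = mat2_of p q r s"
    using mat2_of_eta by blast
  define E where "E = \<bar>c\<bar> * (k * 2)"
  have ex: "exp (x/2) \<le> 2" "exp (-x/2) \<le> 2"
    using x by (auto intro: order_trans [OF _ exp_half_le_2])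
  have bound: "\<bar>c * (y * e)\<bar> \<le> E" if "\<bar>y\<bar> \<le> k" "0 \<le> e" "e \<le> 2" for y e
    unfolding E_def abs_mult using that k by (intro mult_mono) auto
  \<comment> \<open>A row of \<open>N\<close> is recovered from its products with the two columns:
    their difference gives \<open>n\<close>, as \<open>\<alpha> + \<beta> \<ge> 1\<close>, and then
    the first product gives \<open>m\<close>.\<close>
  have row: "\<bar>n\<bar> \<le> 3 * E \<and> \<bar>m\<bar> \<le> 3 * E"
    if 1: "\<bar>n * \<alpha> + m\<bar> \<le> E" and 2: "\<bar>m - n * \<beta>\<bar> \<le> E" for n m
  proof -
    have "n * (\<alpha> + \<beta>) = (n * \<alpha> + m) - (m - n * \<beta>)"
      by (simp add: algebra_simps)
    then have "\<bar>n * (\<alpha> + \<beta>)\<bar> \<le> 2 * E"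
      using 1 2 by linarith
    moreover have "\<bar>n\<bar> * 1 \<le> \<bar>n\<bar> * (\<alpha> + \<beta>)"
      using ab by (intro mult_left_mono) auto
    ultimately have n: "\<bar>n\<bar> \<le> 2 * E"
      using ab by (simp add: abs_mult)
    moreover have "\<bar>n * \<alpha>\<bar> \<le> \<bar>n\<bar>"
      using ab by (simp add: abs_mult mult_left_le)
    ultimately show ?thesis
      using 1 by linarith
  qed
  have e: "p * \<alpha> + q = c * (\<alpha>' * exp (x/2))" "q - p * \<beta> = c * (- \<beta>' * exp (-x/2))"
    "r * \<alpha> + s = c * (1 * exp (x/2))" "s - r * \<beta> = c * (1 * exp (-x/2))"
    using eq by (simp_all add: N_eq endpoint_mat_def aH_mat2_of)
  have "\<bar>p\<bar> \<le> 3 * E \<and> \<bar>q\<bar> \<le> 3 * E"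
    by (rule row; unfold e; rule bound) (use ab k ex in auto)
  moreover have "\<bar>r\<bar> \<le> 3 * E \<and> \<bar>s\<bar> \<le> 3 * E"
    by (rule row; unfold e; rule bound) (use ab k ex in auto)
  moreover have "3 * E \<le> 6 * k\<^sup>2"
    using mult_right_mono [OF c, of k] k by (simp add: E_def power2_eq_square)
  ultimately show ?thesis
    using N by (simp add: bounded_int_mats_def GL2Z_mat2_of N_eq forall_2 k_def)
qed

text \<open>The two matrices differ by a scalar and a diagonal matrix on the right, which preserves
  the ratio in the first column.\<close>

lemma endpoint_mat_eq_if_same_direction:
  assumes "endpoint_mat \<alpha> \<beta> = r *\<^sub>R (\<sigma> ** (h ** aH t))" "endpoint_mat \<alpha>' \<beta>' = r' *\<^sub>R (\<sigma> ** (h ** aH t'))" "r \<noteq> 0"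
  shows "\<alpha> = \<alpha>'"
proof -
  have "endpoint_mat \<alpha>' \<beta>' = (r' / r) *\<^sub>R (r *\<^sub>R (\<sigma> ** (h ** (aH t ** aH (t' - t)))))"
    using assms(2,3) by (simp add: aH_add)
  also have "\<dots> = (r' / r) *\<^sub>R (endpoint_mat \<alpha> \<beta> ** aH (t' - t))"
    unfolding assms(1) by (simp add: scaleR_matrix_mult matrix_mul_assoc)
  finally obtain c where "endpoint_mat \<alpha>' \<beta>' = c *\<^sub>R (endpoint_mat \<alpha> \<beta> ** aH (t' - t))"
    by blast
  then show ?thesis
    by (simp add: endpoint_mat_def aH_mat2_of)
qed

text \<open>All the normalised endpoint matrices of one orbit lie in a fixed compact set, so within unit
  time the orbit meets boundedly many of them.\<close>

lemma card_words_of_orbit: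
  fixes a b :: "nat list \<Rightarrow> real"
  assumes ends: "\<And>w. w \<in> A \<Longrightarrow> endpoints K w (a w) (b w)"
    and even: "\<And>w. w \<in> A \<Longrightarrow> even (length w)"
    and len: "\<And>w. w \<in> A \<Longrightarrow> length w \<le> L"
    and M: "\<And>w. w \<in> A \<Longrightarrow> 4 * wt w 0 1 \<le> exp M"
    and orbit: "\<And>w. w \<in> A \<Longrightarrow> Horbit (endpoint_mat (a w) (b w)) = Ob"
  shows "card A \<le> (nat \<lfloor>M\<rfloor> + 1) * ((L + 1) * card (bounded_int_mats (6 * (real K + 2)\<^sup>2)))"
proof (cases "A = {}")
  case False
  then obtain w0 where w0: "w0 \<in> A"
    by blast
  define h where "h w = endpoint_mat (a w) (b w)" for w
  obtain T where T: "0 < T" "cf_mat w0 ** h w0 = h w0 ** aH T" "trace (cf_mat w0) = exp (T/2) + exp (-T/2)"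
    using cf_mat_hyperbolic [OF ends even] w0 by (auto simp: h_def)
  have cls_T: "cls (h w0 ** aH T) = cls (h w0)"
    by (rule cls_aH_period [OF cf_mat_GL2Z T(2)])
  have "set w0 \<subseteq> {1..K}"
    using ends [OF w0] by (simp add: endpoints_def)
  have "exp (T/2) ^ 2 \<le> (trace (cf_mat w0))\<^sup>2"
    unfolding T(3) by (intro power_mono) auto
  also have "\<dots> \<le> exp M"
    using trace_cf_mat_square_le [OF \<open>set w0 \<subseteq> {1..K}\<close>] M [OF w0] by linarith
  finally have "T \<le> M"
    by (simp add: exp_double [symmetric])
  have "\<exists>t r \<sigma>. 0 \<le> t \<and> t < T \<and> r \<noteq> 0 \<and> \<sigma> \<in> GL2Z \<and> h w = r *\<^sub>R (\<sigma> ** (h w0 ** aH t))"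
    if w: "w \<in> A" for w
  proof -
    have "cls (h w) \<in> Horbit (h w0)"
      using orbit w w0 cls_in_Horbit [of "h w"] by (simp add: h_def)
    then obtain t where "cls (h w) = cls (h w0 ** aH t)"
      by (auto simp: Horbit_eq)
    moreover obtain t' where "0 \<le> t'" "t' < T" "cls (h w0 ** aH t) = cls (h w0 ** aH t')"
      using cls_aH_reduce [OF cls_T T(1)] .
    ultimately show ?thesis
      by (metis cls_eq_iff cls_iff)
  qed
  then obtain t r \<sigma> where *: "\<And>w. w \<in> A \<Longrightarrow> 0 \<le> t w" "\<And>w. w \<in> A \<Longrightarrow> t w < T"
    "\<And>w. w \<in> A \<Longrightarrow> r w \<noteq> 0" "\<And>w. w \<in> A \<Longrightarrow> \<sigma> w \<in> GL2Z"
    "\<And>w. w \<in> A \<Longrightarrow> h w = r w *\<^sub>R (\<sigma> w ** (h w0 ** aH (t w)))"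
    by metis
  \<comment> \<open>One reference word for each unit time slot; comparing words only with the
    reference of their own slot keeps the time difference at most 1.\<close>
  define rep where "rep k = (SOME u. u \<in> A \<and> nat \<lfloor>t u\<rfloor> = k)" for k
  have rep: "rep (nat \<lfloor>t w\<rfloor>) \<in> A" "nat \<lfloor>t (rep (nat \<lfloor>t w\<rfloor>))\<rfloor> = nat \<lfloor>t w\<rfloor>" if "w \<in> A" for w
    using someI [of "\<lambda>u. u \<in> A \<and> nat \<lfloor>t u\<rfloor> = nat \<lfloor>t w\<rfloor>" w] that by (auto simp: rep_def)
  define N where "N w = \<sigma> w ** matrix_inv (\<sigma> (rep (nat \<lfloor>t w\<rfloor>)))" for w
  \<comment> \<open>Slot and \<open>N\<close> determine \<open>\<sigma> w\<close>, hence the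
    endpoint \<open>a w\<close>. The length is recorded too because a word and its powers share
    their endpoints.\<close>
  define f where "f w = (nat \<lfloor>t w\<rfloor>, length w, N w)" for w
  let ?I = "bounded_int_mats (6 * (real K + 2)\<^sup>2)"
  have "inj_on f A"
  proof (rule inj_onI)
    fix v w assume v: "v \<in> A" and w: "w \<in> A" and eq: "f v = f w"
    let ?u = "rep (nat \<lfloor>t w\<rfloor>)"
    have "\<sigma> v ** matrix_inv (\<sigma> ?u) = \<sigma> w ** matrix_inv (\<sigma> ?u)" and len: "length v = length w"
      using eq by (auto simp: f_def N_def)
    then have "\<sigma> v ** (matrix_inv (\<sigma> ?u) ** \<sigma> ?u) = \<sigma> w ** (matrix_inv (\<sigma> ?u) ** \<sigma> ?u)"
      by (simp only: matrix_mul_assoc)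
    then have "\<sigma> v = \<sigma> w"
      using GL2Z_matrix_inv [OF *(4) [OF rep(1) [OF w]]] by simp
    then have "a v = a w"
      using endpoint_mat_eq_if_same_direction [of "a v" "b v" "r v" "\<sigma> v" "h w0" "t v" "a w" "b w" "r w" "t w"] v w *
      by (simp add: h_def)
    moreover have "cf_value v (a v) = a v" "cf_value w (a w) = a w" "0 \<notin> set v" "0 \<notin> set w" "0 < a w"
      using ends [OF v] ends [OF w] by (auto simp: endpoints_def)
    ultimately show "v = w"
      using cf_value_inj [OF len, of "a w" "a w"] endpoints_less_1 [OF ends [OF w]] by simp
  qed
  moreover have "f ` A \<subseteq> {..nat \<lfloor>M\<rfloor>} \<times> ({..L} \<times> ?I)"
  proof (rule image_subsetI)
    fix w assume w: "w \<in> A"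
    define u where "u = rep (nat \<lfloor>t w\<rfloor>)"
    have u: "u \<in> A" "nat \<lfloor>t u\<rfloor> = nat \<lfloor>t w\<rfloor>"
      using rep [OF w] by (auto simp: u_def)
    have "\<lfloor>t w\<rfloor> \<le> \<lfloor>M\<rfloor>"
      using *(2) [OF w] \<open>T \<le> M\<close> by (intro floor_mono) simp
    then have "nat \<lfloor>t w\<rfloor> \<le> nat \<lfloor>M\<rfloor>"
      by (rule nat_mono)
    moreover have "N w \<in> ?I"
    proof (rule change_of_endpoints_bounded [OF _ ends [OF u(1)] ends [OF w]])
      show "N w \<in> GL2Z"
        unfolding N_def u_def [symmetric] by (intro GL2Z_mult GL2Z_matrix_inv(1) *(4) w u(1))
      have "\<lfloor>t u\<rfloor> = \<lfloor>t w\<rfloor>"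
        using u(2) *(1) [OF w] *(1) [OF u(1)] by (simp only: eq_nat_nat_iff zero_le_floor)
      then show "\<bar>t u - t w\<bar> \<le> 1"
        by linarith
      have "N w ** h u = r u *\<^sub>R (\<sigma> w ** (matrix_inv (\<sigma> u) ** \<sigma> u) ** (h w0 ** aH (t u)))"
        by (simp only: N_def u_def [symmetric] *(5) [OF u(1)] scaleR_matrix_mult matrix_mul_assoc)
      also have "\<dots> = (r u / r w) *\<^sub>R (r w *\<^sub>R (\<sigma> w ** (h w0 ** (aH (t w) ** aH (t u - t w)))))"
        by (simp only: GL2Z_matrix_inv(2) [OF *(4) [OF u(1)]] aH_add scaleR_scaleR matrix_mul_rid) (simp add: *(3) [OF w])
      also have "\<dots> = (r u / r w) *\<^sub>R (h w ** aH (t u - t w))"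
        by (simp only: *(5) [OF w] scaleR_matrix_mult matrix_mul_assoc)
      finally show "N w ** endpoint_mat (a u) (b u) = (r u / r w) *\<^sub>R (endpoint_mat (a w) (b w) ** aH (t u - t w))"
        by (simp add: h_def)
    qed
    ultimately show "f w \<in> {..nat \<lfloor>M\<rfloor>} \<times> ({..L} \<times> ?I)"
      using len [OF w] by (simp add: f_def)
  qed
  ultimately have "card A \<le> card ({..nat \<lfloor>M\<rfloor>} \<times> ({..L} \<times> ?I))"
    using finite_bounded_int_mats by (intro card_inj_on_le) auto
  then show ?thesis
    by (simp add: card_cartesian_product)
qed simp

section \<open>Choice of constants and the lower bound for the number of orbits\<close>

theorem theorem1p2:
  fixes \<epsilon> :: real
  assumes "\<epsilon> > 0"
  shows "\<exists>\<delta>>0. \<exists>c>0. \<forall>\<^sub>F \<Delta> in at_top.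
     (\<Sum>\<^sub>\<infinity> Ob\<in>{Ob. periodic Ob \<and> orbit_disc Ob \<le> \<Delta> \<and> Ob \<subseteq> Omega' \<delta>}. ennreal (orbit_vol Ob))
       \<ge> ennreal (c * \<Delta> powr (1 - \<epsilon>))"
proof -
  \<comment> \<open>An exponent strictly between \<open>1 - \<epsilon>\<close> and 1, kept
    nonnegative when \<epsilon> is large. The surplus \<eta> pays for the logarithms.\<close>
  define s where "s = max (1/2) (1 - \<epsilon>/2)"
  define \<eta> where "\<eta> = s - (1 - \<epsilon>)"
  have s: "0 \<le> s" "s < 1" and "0 < \<eta>"
    using assms by (auto simp: s_def \<eta>_def max_def)
  define q :: real where "q = 2 powr (1 - s)"
  have "1 < q"
    using s by (simp add: q_def)
  \<comment> \<open>Large enough that the halving gain \<open>q\<close> outweighs the loss factor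
    \<open>1 - 2 / (K + 2)\<close>.\<close>
  obtain K :: nat where K: "2 / (1 - 1/q) < real K"
    using reals_Archimedean2 by blast
  have "1 / q * q \<le> (1 - 2 / (real K + 2)) * q"
  proof (intro mult_right_mono)
    have "2 < (1 - 1/q) * (real K + 2)"
    proof -
      have "2 < (1 - 1/q) * real K"
        using K \<open>1 < q\<close> by (simp add: pos_divide_less_eq mult.commute)
      moreover have "0 < 1 - 1/q"
        using \<open>1 < q\<close> by simp
      ultimately show ?thesis
        by (simp add: distrib_left)
    qed
    then have "2 / (real K + 2) < 1 - 1/q"
      by (simp add: pos_divide_less_eq)
    then show "1 / q \<le> 1 - 2 / (real K + 2)"
      by linarith
  qed (use \<open>1 < q\<close> in simp)
  then have Kq: "1 \<le> 2 powr (1 - s) * (1 - 2 / (real K + 2))"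
    using \<open>1 < q\<close> by (simp add: q_def mult.commute)
  have "1 \<le> K"
  proof -
    have "0 < 2 / (1 - 1/q)"
      using \<open>1 < q\<close> by simp
    then have "0 < real K"
      using K by linarith
    then show ?thesis
      by simp
  qed
  define R where "R = (real K + 1) ^ 4"
  define C where "C = real (card (bounded_int_mats (6 * (real K + 2)\<^sup>2))) + 1"
  have "0 < R" "0 < C"
    by (simp_all add: R_def C_def add_nonneg_pos)
  \<comment> \<open>96 = 16 * 6, where 16 comes from \<open>\<Delta> = 16 * R * X\<close> and 6 is
    \<open>d * (c + d)\<close> at the starting row \<open>(1, 2)\<close>.\<close>
  define c where "c = (1 / (96 * R)) powr s / C"
  have "0 < c"
    using \<open>0 < R\<close> \<open>0 < C\<close> by (simp add: c_def)
  have "ennreal (c * \<Delta> powr (1 - \<epsilon>)) \<le>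
      (\<Sum>\<^sub>\<infinity> Ob\<in>{Ob. periodic Ob \<and> orbit_disc Ob \<le> \<Delta> \<and> Ob \<subseteq> Omega' (height_gap K)}. ennreal (orbit_vol Ob))"
    if \<Delta>: "96 \<le> \<Delta>" "(1 + 2 * ln \<Delta>)\<^sup>2 \<le> \<Delta> powr \<eta>" for \<Delta>
  proof -
    \<comment> \<open>The discriminant is at most four times the squared trace, hence at most 16
      times the weight, so weights up to \<open>\<Delta> / 16\<close> are admissible.\<close>
    define X where "X = \<Delta> / (16 * R)"
    have RX: "R * X = \<Delta> / 16"
      using \<open>0 < R\<close> by (simp add: X_def)
    define W where "W = {w. set w \<subseteq> {1..K} \<and> even (length w) \<and> wt w 1 2 \<le> R * X}"
    have W: "(X / 6) powr s \<le> real (card W)"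
      using card_wt_le [OF s(1) less_imp_le [OF s(2)] Kq, of X 1 2] \<Delta>(1) \<open>0 < R\<close>
      unfolding R_def [symmetric] RX W_def by (simp add: X_def)
    \<comment> \<open>The prefix 1, 1 leads from the row \<open>(0, 1)\<close> to
      \<open>(1, 2)\<close>. It makes every word nonempty and preserves even length.\<close>
    define A where "A = (\<lambda>w. 1 # 1 # w :: nat list) ` W"
    have "finite A"
      using finite_wt_le [of 1 2 K "R * X"] by (simp add: A_def W_def)
    have card_A: "card A = card W"
      unfolding A_def by (rule card_image) (simp add: inj_on_def)
    have A: "w \<noteq> []" "set w \<subseteq> {1..K}" "even (length w)" "16 * wt w 0 1 \<le> \<Delta>" if "w \<in> A" for w
      using that \<open>1 \<le> K\<close> by (auto simp: A_def W_def RX)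
    have "\<forall>w\<in>A. \<exists>p. endpoints K w (fst p) (snd p)"
      using endpoints_exist [OF A(1,2)] by simp
    then obtain p where p: "\<forall>w\<in>A. endpoints K w (fst (p w)) (snd (p w))"
      by (rule bchoice [THEN exE])
    define a b where "a w = fst (p w)" and "b w = snd (p w)" for w
    have ends: "endpoints K w (a w) (b w)" if "w \<in> A" for w
      using p that by (simp add: a_def b_def)
    define Ob where "Ob w = Horbit (endpoint_mat (a w) (b w))" for w
    have Ob: "periodic (Ob w)" "orbit_disc (Ob w) \<le> \<Delta>" "Ob w \<subseteq> Omega' (height_gap K)" "1 \<le> orbit_vol (Ob w)"
      if w: "w \<in> A" for w
    proof -
      obtain T where T: "0 < T" "cf_mat w ** endpoint_mat (a w) (b w) = endpoint_mat (a w) (b w) ** aH T"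
        using cf_mat_hyperbolic [OF ends [OF w] A(3) [OF w]] by blast
      note h = endpoint_mat_GL2R [OF ends [OF w]]
      note cls_T = cls_aH_period [OF cf_mat_GL2Z T(2)]
      show "periodic (Ob w)"
        unfolding Ob_def by (rule periodic_Horbit [OF h cls_T T(1)])
      show "Ob w \<subseteq> Omega' (height_gap K)"
        unfolding Ob_def by (rule Horbit_subset_Omega' [OF ends [OF w] cls_T T(1)])
      show "1 \<le> orbit_vol (Ob w)"
        unfolding Ob_def by (rule orbit_vol_ge_1 [OF h cls_T T(1)])
      show "orbit_disc (Ob w) \<le> \<Delta>"
        using orbit_disc_le [OF h cf_mat_GL2Z T(2,1)] trace_cf_mat_square_le [OF A(2) [OF w]] A(4) [OF w]
        unfolding Ob_def by linarith
    qed
    define l where "l = ln \<Delta>"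
    have l: "0 \<le> l" "exp l = \<Delta>"
      using \<Delta>(1) by (simp_all add: l_def)
    have fibre: "real (card {w \<in> A. Ob w = O'}) \<le> (1 + 2 * l)\<^sup>2 * C" for O'
    proof -
      have "card {w \<in> A. Ob w = O'} \<le> (nat \<lfloor>l\<rfloor> + 1) * ((nat \<lfloor>2 * l\<rfloor> + 1) * card (bounded_int_mats (6 * (real K + 2)\<^sup>2)))"
      proof (rule card_words_of_orbit [where a = a and b = b and Ob = O'])
        fix w assume "w \<in> {w \<in> A. Ob w = O'}"
        then have w: "w \<in> A" "Ob w = O'"
          by auto
        show "endpoints K w (a w) (b w)" "even (length w)" "Horbit (endpoint_mat (a w) (b w)) = O'"
          using ends A w by (auto simp: Ob_def)
        have *: "2 ^ length w \<le> wt w 0 1"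
          using wt_ge_power_length [OF A(2) [OF w(1)], of 0 1] by simp
        then have "0 < wt w 0 1"
          by (rule less_le_trans [rotated]) simp
        then show "4 * wt w 0 1 \<le> exp l"
          using A(4) [OF w(1)] l by linarith
        \<comment> \<open>The weight is at least \<open>2 ^ length w\<close>, so this crude bound
          makes the length at most \<open>2 * ln \<Delta>\<close>.\<close>
        have "exp (1/2) ^ length w \<le> (2::real) ^ length w"
          by (intro power_mono exp_half_le_2) simp
        also have "\<dots> \<le> exp l"
          using * A(4) [OF w(1)] \<open>0 < wt w 0 1\<close> l by linarith
        finally have "exp (real (length w) * (1/2)) \<le> exp l"
          by (simp only: exp_of_nat_mult)
        then have "real (length w) \<le> 2 * l"
          by simp
        then show "length w \<le> nat \<lfloor>2 * l\<rfloor>"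
          by (simp add: le_nat_floor)
      qed
      then have "real (card {w \<in> A. Ob w = O'}) \<le>
          real ((nat \<lfloor>l\<rfloor> + 1) * ((nat \<lfloor>2 * l\<rfloor> + 1) * card (bounded_int_mats (6 * (real K + 2)\<^sup>2))))"
        by (simp only: of_nat_le_iff)
      also have "\<dots> = (real (nat \<lfloor>l\<rfloor>) + 1) * ((real (nat \<lfloor>2 * l\<rfloor>) + 1) * (C - 1))"
        by (simp add: C_def algebra_simps)
      also have "\<dots> \<le> (1 + 2 * l) * ((1 + 2 * l) * C)"
      proof (intro mult_mono)
        show "real (nat \<lfloor>l\<rfloor>) + 1 \<le> 1 + 2 * l" "real (nat \<lfloor>2 * l\<rfloor>) + 1 \<le> 1 + 2 * l"
          using of_nat_floor [of l] of_nat_floor [of "2 * l"] l by linarith+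
      qed (use l in \<open>auto simp: C_def\<close>)
      finally show ?thesis
        by (simp add: power2_eq_square mult.assoc)
    qed
    have "c * \<Delta> powr (1 - \<epsilon>) \<le> real (card (Ob ` A))"
    proof -
      \<comment> \<open>Words are grouped by their orbit; dividing their number by the maximal group
        size bounds the number of orbits from below.\<close>
      have "A = (\<Union>O'\<in>Ob ` A. {w \<in> A. Ob w = O'})"
        by auto
      then have "card A \<le> (\<Sum>O'\<in>Ob ` A. card {w \<in> A. Ob w = O'})"
        using card_UN_le [of "Ob ` A" "\<lambda>O'. {w \<in> A. Ob w = O'}"] \<open>finite A\<close> by simp
      then have "real (card A) \<le> (\<Sum>O'\<in>Ob ` A. real (card {w \<in> A. Ob w = O'}))"
        by (simp only: of_nat_sum [symmetric] of_nat_le_iff)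
      also have "\<dots> \<le> (\<Sum>O'\<in>Ob ` A. (1 + 2 * l)\<^sup>2 * C)"
        by (intro sum_mono fibre)
      also have "\<dots> = real (card (Ob ` A)) * ((1 + 2 * l)\<^sup>2 * C)"
        by simp
      also have "\<dots> \<le> real (card (Ob ` A)) * (\<Delta> powr \<eta> * C)"
        using \<Delta>(2) \<open>0 < C\<close> by (intro mult_left_mono mult_right_mono) (auto simp: l_def)
      finally have *: "(X / 6) powr s \<le> real (card (Ob ` A)) * (\<Delta> powr \<eta> * C)"
        using W card_A by linarith
      have "X / 6 = 1 / (96 * R) * \<Delta>"
        by (simp add: X_def)
      then have "(X / 6) powr s = c * C * \<Delta> powr s"
        using \<open>0 < C\<close> \<open>0 < R\<close> \<Delta>(1) by (simp only: powr_mult) (simp add: c_def)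
      moreover have "\<Delta> powr s = \<Delta> powr (1 - \<epsilon>) * \<Delta> powr \<eta>"
        by (simp add: \<eta>_def flip: powr_add)
      ultimately have "(c * \<Delta> powr (1 - \<epsilon>)) * (\<Delta> powr \<eta> * C) \<le> real (card (Ob ` A)) * (\<Delta> powr \<eta> * C)"
        using * by (simp only: mult_ac)
      moreover have "0 < \<Delta> powr \<eta> * C"
        using \<Delta>(1) \<open>0 < C\<close> by simp
      ultimately show ?thesis
        by (rule mult_right_le_imp_le)
    qed
    then have "ennreal (c * \<Delta> powr (1 - \<epsilon>)) \<le> ennreal (real (card (Ob ` A)))"
      by (rule ennreal_leI)
    also have "\<dots> = (\<Sum>O'\<in>Ob ` A. 1)"
      by (simp add: ennreal_of_nat_eq_real_of_nat)
    also have "\<dots> \<le> (\<Sum>O'\<in>Ob ` A. ennreal (orbit_vol O'))"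
      using Ob(4) by (intro sum_mono) (auto simp flip: ennreal_1 intro: ennreal_leI)
    \<comment> \<open>A nonnegative infinite sum is the supremum of its finite partial sums, one of
      which runs over the orbits constructed here.\<close>
    also have "\<dots> \<le> (\<Sum>\<^sub>\<infinity> Ob\<in>{Ob. periodic Ob \<and> orbit_disc Ob \<le> \<Delta> \<and> Ob \<subseteq> Omega' (height_gap K)}. ennreal (orbit_vol Ob))"
      using Ob(1-3) \<open>finite A\<close> by (subst nonneg_infsum_complete) (auto intro!: SUP_upper)
    finally show ?thesis .
  qed
  moreover have "\<forall>\<^sub>F \<Delta> in at_top. 96 \<le> \<Delta> \<and> (1 + 2 * ln \<Delta>)\<^sup>2 \<le> \<Delta> powr \<eta>"
    using \<open>0 < \<eta>\<close> by (intro eventually_conj eventually_ge_at_top) real_asymp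
  ultimately have "\<forall>\<^sub>F \<Delta> in at_top. ennreal (c * \<Delta> powr (1 - \<epsilon>)) \<le>
      (\<Sum>\<^sub>\<infinity> Ob\<in>{Ob. periodic Ob \<and> orbit_disc Ob \<le> \<Delta> \<and> Ob \<subseteq> Omega' (height_gap K)}. ennreal (orbit_vol Ob))"
    by (auto elim: eventually_mono)
  then show ?thesis
    using height_gap_pos \<open>0 < c\<close> by blast
qed

end
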